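(* Let $n\ge 2$ and let $w$ be an element of the affine symmetric group $\tilde S_n$. Then the affine Schubert polynomial $\tilde{\mathfrak S}_w$ is monomial-positive: it is a linear combination with nonnegative integer coefficients of products $m_\lambda\,x_1^{a_1}\cdots x_n^{a_n}$, where $m_\lambda$ are monomial symmetric functions.
   Context: Let $G=\mathrm{SL}(n)$, with affine Weyl group $\tilde S_n$ (simple reflections $s_0,\dots,s_{n-1}$) and finite Weyl group $S_n$. Let $\Lambda$ be the ring of symmetric functions and $I_n=\langle m_\lambda:\lambda_1\ge n\rangle$. There are isomorphisms $H^*(\mathrm{Gr}_G)\cong\Lambda/I_n$ and $H^*(G/B)\cong\mathbb Z[x_1,\dots,x_n]/\langle e_j(x_1,\dots,x_n):j\ge1\rangle$, giving $H^*(\hat{\mathrm{Fl}}_G)\cong\Lambda/I_n\otimes_{\mathbb Z}\mathbb Z[x_1,\dots,x_n]/\langle e_j(x_1,\dots,x_n):j\ge1\rangle$. The affine Schubert polynomial $\tilde{\mathfrak S}_w$ (of S. Lee) is a polynomial representative, in $\Lambda\otimes\mathbb Z[x_1,\dots,x_n]$, of the Schubert class $\xi^w\in H^*(\hat{\mathrm{Fl}}_G)$ under this isomorphism; it equals $\sum_{w\doteq uv,\ u\in\tilde S_n,\ v\in S_n}F_u\,\mathfrak S_v(x)$, where $F_u$ is the affine Stanley symmetric function, $\mathfrak S_v$ the Schubert polynomial, and $w\doteq uv$ means $w=uv$ with $\ell(w)=\ell(u)+\ell(v)$. *)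

theory Defs
  imports Main "HOL-Library.Poly_Mapping" "HOL-Library.Multiset"
begin

definition affine_perm :: "nat \<Rightarrow> (int \<Rightarrow> int) \<Rightarrow> bool" where
  "affine_perm n w \<longleftrightarrow> bij w \<and> (\<forall>i. w (i + int n) = w i + int n) \<and>
     (\<Sum>i\<in>{1..int n}. w i) = int n * (int n + 1) div 2"

definition sref :: "nat \<Rightarrow> nat \<Rightarrow> int \<Rightarrow> int" where
  "sref n k i = (if i mod int n = int k then i + 1
                 else if i mod int n = (int k + 1) mod int n then i - 1 else i)"

definition word_prod :: "nat \<Rightarrow> nat list \<Rightarrow> int \<Rightarrow> int" where
  "word_prod n ws = foldr (\<lambda>k f. sref n k \<circ> f) ws id"

definition alen :: "nat \<Rightarrow> (int \<Rightarrow> int) \<Rightarrow> nat" where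
  "alen n w = (LEAST k. \<exists>ws. set ws \<subseteq> {0..<n} \<and> length ws = k \<and> word_prod n ws = w)"

definition fin_perm :: "nat \<Rightarrow> (int \<Rightarrow> int) \<Rightarrow> bool" where
  "fin_perm n v \<longleftrightarrow> affine_perm n v \<and> v ` {1..int n} = {1..int n}"

definition cyc_dec :: "nat \<Rightarrow> (int \<Rightarrow> int) \<Rightarrow> bool" where
  "cyc_dec n v \<longleftrightarrow> (\<exists>ws. set ws \<subseteq> {0..<n} \<and> distinct ws \<and> word_prod n ws = v \<and>
      length ws = alen n v \<and>
      (\<forall>p q. p < length ws \<longrightarrow> q < length ws \<longrightarrow> ws ! q = (ws ! p + 1) mod n \<longrightarrow> q < p))"

text \<open>Symmetric functions in variables y_0, y_1, ... are represented by their coefficient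
  functions on monomials alpha (finitely supported exponent vectors).
  [y^alpha] F_u = number of length-additive factorizations u = v^0 v^1 ... v^(N-1)
  into cyclically decreasing elements with l(v^i) = alpha_i.\<close>
definition ybound :: "(nat \<Rightarrow>\<^sub>0 nat) \<Rightarrow> nat" where
  "ybound \<alpha> = (if Poly_Mapping.keys \<alpha> = {} then 0 else Suc (Max (Poly_Mapping.keys \<alpha>)))"

definition affine_stanley_coeff :: "nat \<Rightarrow> (int \<Rightarrow> int) \<Rightarrow> (nat \<Rightarrow>\<^sub>0 nat) \<Rightarrow> nat" where
  "affine_stanley_coeff n u \<alpha> = card {vs. length vs = ybound \<alpha> \<and>
      (\<forall>i < ybound \<alpha>. cyc_dec n (vs ! i) \<and> alen n (vs ! i) = Poly_Mapping.lookup \<alpha> i) \<and>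
      foldr (\<circ>) vs id = u \<and> alen n u = (\<Sum>i<ybound \<alpha>. Poly_Mapping.lookup \<alpha> i)}"

type_synonym mpoly = "(nat \<Rightarrow>\<^sub>0 nat) \<Rightarrow>\<^sub>0 int"

definition Xvar :: "nat \<Rightarrow> mpoly" where
  "Xvar i = Poly_Mapping.single (Poly_Mapping.single i 1) 1"

definition swapnat :: "nat \<Rightarrow> nat \<Rightarrow> nat" where
  "swapnat i k = (if k = i then i + 1 else if k = i + 1 then i else k)"

definition swapv :: "nat \<Rightarrow> mpoly \<Rightarrow> mpoly" where
  "swapv i p = Poly_Mapping.map_key (Poly_Mapping.map_key (swapnat i)) p"

definition ddiff :: "nat \<Rightarrow> mpoly \<Rightarrow> mpoly" where
  "ddiff i f = (THE g. (Xvar i - Xvar (i + 1)) * g = f - swapv i f)"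

definition w0 :: "nat \<Rightarrow> int \<Rightarrow> int" where
  "w0 n i = ((i - 1) div int n) * int n + int n - (i - 1) mod int n"

definition schub_top :: "nat \<Rightarrow> mpoly" where
  "schub_top n = (\<Prod>i\<in>{1..<n}. Xvar i ^ (n - i))"

definition schub :: "nat \<Rightarrow> (int \<Rightarrow> int) \<Rightarrow> mpoly" where
  "schub n v = (SOME p. \<exists>ws. set ws \<subseteq> {1..<n} \<and> word_prod n ws = w0 n \<circ> v \<and>
       length ws = alen n (w0 n \<circ> v) \<and> p = fold ddiff ws (schub_top n))"

definition aff_schub_coeff :: "nat \<Rightarrow> (int \<Rightarrow> int) \<Rightarrow> (nat \<Rightarrow>\<^sub>0 nat) \<Rightarrow> (nat \<Rightarrow>\<^sub>0 nat) \<Rightarrow> int" where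
  "aff_schub_coeff n w \<alpha> a = (\<Sum>(u, v)\<in>{(u, v). affine_perm n u \<and> fin_perm n v \<and> w = u \<circ> v \<and>
        alen n w = alen n u + alen n v}.
      int (affine_stanley_coeff n u \<alpha>) * Poly_Mapping.lookup (schub n v) a)"

definition is_partition :: "nat list \<Rightarrow> bool" where
  "is_partition lam \<longleftrightarrow> sorted_wrt (\<ge>) lam \<and> (\<forall>x\<in>set lam. 0 < x)"

definition mono_sym :: "nat list \<Rightarrow> (nat \<Rightarrow>\<^sub>0 nat) \<Rightarrow> int" where
  "mono_sym lam \<alpha> = (if is_partition lam \<and> mset lam = image_mset (Poly_Mapping.lookup \<alpha>) (mset_set (Poly_Mapping.keys \<alpha>))
                    then 1 else 0)"

end

theory Submission
  imports
    Defs "HOL-Library.FuncSet" "HOL-Combinatorics.Transposition"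
    "HOL-Computational_Algebra.Polynomial"
begin

text \<open>
  Let u_i be the i-th generator of the nilCoxeter algebra, acting on functions of integer sequences.
  The operators exp (x u_i) = 1 + x u_i satisfy the Yang-Baxter equation, and both halves of the
  theorem follow from it.

  Positivity of Schubert polynomials (after Fomin and Stanley): the coefficient of v in the staircase
  product of the operators 1 + X_j u_i is visibly a polynomial with nonnegative coefficients, and the
  Yang-Baxter equation shows that divided differences act on it as they do on Schubert polynomials.

  Symmetry of affine Stanley functions: multiplying w by a cyclically decreasing element cuts the
  sequence w into periodic blocks, each ending in its maximum, and moves each maximum to the front of
  its block. Read from right to left, this is one carrier travelling through the sequence with
  an operator 1 + x u_i at each site, so the generating function of products of two such elements is a
  trace over the pair of carriers, twisted by the shift by n. The Yang-Baxter equation conjugates the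
  two orders of the parameters x and y into one another, and the trace is invariant.
\<close>

section \<open>Length of affine permutations\<close>

lemma sum_periodic_window:
  fixes f :: "int \<Rightarrow> 'a::ab_group_add"
  assumes per: "\<And>i. f (i + int n) = f i"
  shows "sum f {a..<a + int n} = sum f {b..<b + int n}"
proof -
  have step: "sum f {c..<c + int n} = sum f {c + 1..<c + 1 + int n}" for c
  proof (cases "n = 0")
    case False
    have "{c..<c + int n} = insert c {c + 1..<c + int n}"
      "{c + 1..<c + 1 + int n} = insert (c + int n) {c + 1..<c + int n}"
      using False by auto
    then show ?thesis by (simp add: per)
  qed simp
  have up: "sum f {c..<c + int n} = sum f {c + int m..<c + int m + int n}" for c m
  proof (induction m)
    case (Suc m)
    then show ?case using step [of "c + int m"] by (simp add: ac_simps)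
  qed simp
  show ?thesis
  proof (cases "a \<le> b")
    case True
    then show ?thesis using up [of a "nat (b - a)"] by simp
  next
    case False
    then show ?thesis using up [of b "nat (a - b)"] by simp
  qed
qed

definition shift_equivariant :: "nat \<Rightarrow> (int \<Rightarrow> int) \<Rightarrow> bool" where
  "shift_equivariant n w \<longleftrightarrow> (\<forall>i. w (i + int n) = w i + int n)"

lemma shift_equivariantD: "shift_equivariant n w \<Longrightarrow> w (i + int n) = w i + int n"
  by (simp add: shift_equivariant_def)

lemma shift_equivariant_mult:
  assumes w: "shift_equivariant n w"
  shows "w (i + int n * q) = w i + int n * q"
proof -
  have up: "w (j + int n * int m) = w j + int n * int m" for j m
  proof (induction m)
    case (Suc m)
    then show ?case
      using shift_equivariantD [OF w, of "j + int n * int m"] by (simp add: algebra_simps)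
  qed simp
  show ?thesis
  proof (cases "q \<ge> 0")
    case True
    then show ?thesis using up [of i "nat q"] by simp
  next
    case False
    then show ?thesis using up [of "i + int n * q" "nat (- q)"] by simp
  qed
qed

lemma shift_equivariant_mod:
  assumes "shift_equivariant n w"
  shows "w i - i = w (i mod int n) - i mod int n"
  using shift_equivariant_mult [OF assms, of "i mod int n" "i div int n"]
  by (simp add: algebra_simps)

lemma shift_equivariant_eqI:
  assumes "n > 0" "shift_equivariant n f" "shift_equivariant n g" "\<And>k. k \<in> {a..<a + int n} \<Longrightarrow> f k = g k"
  shows "f = g"
proof
  fix k
  let ?r = "a + (k - a) mod int n" and ?q = "(k - a) div int n"
  have k: "k = ?r + int n * ?q" by simp
  have "f ?r = g ?r" using assms(1) by (intro assms(4)) simp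
  then show "f k = g k"
    by (subst (1 2) k)
      (simp only: shift_equivariant_mult [OF assms(2)] shift_equivariant_mult [OF assms(3)])
qed

definition later_below :: "(int \<Rightarrow> int) \<Rightarrow> int \<Rightarrow> int \<Rightarrow> int set" where
  "later_below w i b = {j. i < j \<and> w j < b}"

definition aff_inversions :: "nat \<Rightarrow> (int \<Rightarrow> int) \<Rightarrow> nat" where
  "aff_inversions n w = (\<Sum>i\<in>{0..<int n}. card (later_below w i (w i)))"

lemma later_below_step:
  "later_below w i b =
    (if w (i + 1) < b then insert (i + 1) (later_below w (i + 1) b) else later_below w (i + 1) b)"
proof -
  have "i < j \<longleftrightarrow> j = i + 1 \<or> i + 1 < j" for j by auto
  then show ?thesis by (auto simp: later_below_def)
qed

lemma finite_later_below:
  assumes "n > 0" and w: "shift_equivariant n w"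
  shows "finite (later_below w i b)"
proof -
  let ?D = "(\<lambda>r. w r - r) ` {0..<int n}"
  have "w j - j \<ge> Min ?D" for j
    unfolding shift_equivariant_mod [OF w, of j] using assms(1)
    by (intro Min_le) (auto intro!: image_eqI [where x = "j mod int n"])
  then have "later_below w i b \<subseteq> {i..b - Min ?D}"
    unfolding later_below_def by (auto simp: algebra_simps) (smt (verit))
  then show ?thesis by (rule finite_subset) simp
qed

lemma card_later_below_shift:
  assumes w: "shift_equivariant n w"
  shows "card (later_below w (i + int n) (b + int n)) = card (later_below w i b)"
proof (rule bij_betw_same_card [where f = "\<lambda>j. j - int n"])
  have "w (j - int n) = w j - int n" for j
    using shift_equivariantD [OF w, of "j - int n"] by simp
  then show "bij_betw (\<lambda>j. j - int n) (later_below w (i + int n) (b + int n)) (later_below w i b)"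
    by (intro bij_betwI [where g = "\<lambda>j. j + int n"])
      (auto simp: later_below_def shift_equivariantD [OF w])
qed

lemma aff_inversions_window:
  assumes w: "shift_equivariant n w"
  shows "int (aff_inversions n w) = (\<Sum>i\<in>{a..<a + int n}. int (card (later_below w i (w i))))"
  unfolding aff_inversions_def
  using sum_periodic_window [of "\<lambda>i. int (card (later_below w i (w i)))" n 0 a]
  by (simp add: card_later_below_shift [OF w] shift_equivariantD [OF w])

lemma aff_inversions_id: "aff_inversions n id = 0"
  by (simp add: aff_inversions_def later_below_def)

lemma affine_perm_equivariant: "affine_perm n w \<Longrightarrow> shift_equivariant n w"
  by (simp add: affine_perm_def shift_equivariant_def)

lemma affine_perm_neq: "affine_perm n w \<Longrightarrow> i \<noteq> j \<Longrightarrow> w i \<noteq> w j"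
  by (auto simp: affine_perm_def bij_def inj_def)

lemma gauss_sum_int: "(\<Sum>i\<in>{1..int n}. i) = int n * (int n + 1) div 2"
proof -
  have "(\<Sum>i\<in>{1..int n}. i) = (\<Sum>i\<in>{1..n}. int i)"
    by (rule sum.reindex_bij_witness [where i = int and j = nat]) auto
  then show ?thesis using gauss_sum_from_Suc_0 [of n, where ?'a = int] by simp
qed

lemma affine_perm_iff:
  "affine_perm n w \<longleftrightarrow> bij w \<and> shift_equivariant n w \<and> (\<Sum>i\<in>{a..<a + int n}. w i - i) = 0"
proof -
  have "(\<Sum>i\<in>{a..<a + int n}. w i - i) = (\<Sum>i\<in>{1..int n}. w i) - int n * (int n + 1) div 2"
    if "shift_equivariant n w"
  proof -
    have "(\<Sum>i\<in>{a..<a + int n}. w i - i) = (\<Sum>i\<in>{1..<1 + int n}. w i - i)"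
      by (rule sum_periodic_window) (simp add: shift_equivariantD [OF that])
    also have "{1..<1 + int n} = {1..int n}" by auto
    finally show ?thesis by (simp add: sum_subtractf gauss_sum_int)
  qed
  then show ?thesis by (auto simp: affine_perm_def shift_equivariant_def)
qed

lemma affine_perm_id: "affine_perm n id"
  by (simp add: affine_perm_iff [of _ _ 0] shift_equivariant_def)

lemma word_prod_Nil: "word_prod n [] = id"
  by (simp add: word_prod_def)

lemma word_prod_Cons: "word_prod n (k # ws) = sref n k \<circ> word_prod n ws"
  by (simp add: word_prod_def)

lemma comp_word_prod_Cons: "w \<circ> word_prod n (k # ws) = (w \<circ> sref n k) \<circ> word_prod n ws"
  by (simp only: word_prod_Cons comp_assoc)

lemma word_prod_append: "word_prod n (xs @ ys) = word_prod n xs \<circ> word_prod n ys"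
  by (induction xs) (simp_all add: word_prod_Nil word_prod_Cons comp_assoc)

lemma word_prod_snoc: "word_prod n (xs @ [k]) = word_prod n xs \<circ> sref n k"
  by (simp add: word_prod_append word_prod_Cons word_prod_Nil)

locale affine_symmetric_group =
  fixes n :: nat
  assumes n_ge_2: "n \<ge> 2"
begin

lemma mod_succ_neq: "(i + 1) mod int n \<noteq> i mod int n"
proof
  assume "(i + 1) mod int n = i mod int n"
  then have "int n dvd (i + 1) - i" by (metis mod_eq_dvd_iff)
  then show False using n_ge_2 by simp
qed

lemma sref_eq:
  assumes "k < n"
  shows "sref n k i =
    (if i mod int n = int k then i + 1 else if (i - 1) mod int n = int k then i - 1 else i)"
proof -
  have "i mod int n = (int k + 1) mod int n \<longleftrightarrow> (i - 1) mod int n = int k mod int n"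
    unfolding mod_eq_dvd_iff by (simp add: algebra_simps)
  then show ?thesis using assms by (simp add: sref_def)
qed

lemma sref_add_period: "sref n k (i + int n) = sref n k i + int n"
  by (simp add: sref_def)

lemma sref_invol: "k < n \<Longrightarrow> sref n k (sref n k i) = i"
  using mod_succ_neq [of i] mod_succ_neq [of "i - 1"] by (auto simp: sref_eq)

lemma sref_comp_sref: "k < n \<Longrightarrow> sref n k \<circ> sref n k = id"
  by (auto simp: sref_invol fun_eq_iff)

lemma bij_sref: "k < n \<Longrightarrow> bij (sref n k)"
  by (rule o_bij [of "sref n k"]) (simp_all add: sref_comp_sref)

lemma sref_self: "k < n \<Longrightarrow> sref n k (int k) = int k + 1"
  by (simp add: sref_eq)

lemma sref_self_Suc: "k < n \<Longrightarrow> sref n k (int k + 1) = int k"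
  using mod_succ_neq [of "int k"] by (simp add: sref_eq)

lemma mod_eq_window_iff:
  assumes "k < n" "i \<in> {int k..<int k + int n}"
  shows "i mod int n = int k \<longleftrightarrow> i = int k"
proof -
  have "i mod int n = int k \<longleftrightarrow> (i - int k) mod int n = 0"
    using assms(1) mod_eq_dvd_iff [of i "int n" "int k"] by (simp add: mod_eq_0_iff_dvd)
  also have "(i - int k) mod int n = i - int k" using assms(2) by (intro mod_pos_pos_trivial) auto
  finally show ?thesis by simp
qed

lemma sref_fixes_window_interior:
  assumes "k < n" "i \<in> {int k + 2..<int k + int n}"
  shows "sref n k i = i"
  using assms mod_eq_window_iff [of k i] mod_eq_window_iff [of k "i - 1"] by (simp add: sref_eq)

lemma window_split:
  "{int k..<int k + int n} = insert (int k) (insert (int k + 1) {int k + 2..<int k + int n})"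
  using n_ge_2 by auto

lemma less_sref_iff:
  assumes "k < n" "i mod int n \<noteq> int k"
  shows "i < sref n k j \<longleftrightarrow> i < j"
  using assms by (cases "j = i"; cases "j = i + 1") (auto simp: sref_eq)

lemma card_later_below_sref:
  assumes k: "k < n" "i mod int n \<noteq> int k"
  shows "card (later_below (w \<circ> sref n k) i b) = card (later_below w i b)"
  by (rule bij_betw_same_card [of "sref n k"], rule bij_betwI [where g = "sref n k"])
    (auto simp: later_below_def less_sref_iff [OF k] sref_invol [OF k(1)])

lemma shift_equivariant_sref: "shift_equivariant n w \<Longrightarrow> shift_equivariant n (w \<circ> sref n k)"
  by (simp add: shift_equivariant_def sref_add_period)

lemma aff_inversions_sref_up:
  assumes k: "k < n" and w: "shift_equivariant n w" and up: "w (int k) < w (int k + 1)"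
  shows "aff_inversions n (w \<circ> sref n k) = aff_inversions n w + 1"
proof -
  let ?v = "w \<circ> sref n k" and ?K = "int k"
  let ?inv = "\<lambda>w i. int (card (later_below w i (w i)))"
  note v = shift_equivariant_sref [OF w, of k]
  have v_K: "?v ?K = w (?K + 1)" "?v (?K + 1) = w ?K"
    using k by (simp_all add: sref_self sref_self_Suc)
  have K_neq: "(?K + 1) mod int n \<noteq> ?K" using mod_succ_neq [of ?K] k by simp
  have at_Suc: "?inv ?v (?K + 1) = ?inv w ?K"
    using up card_later_below_sref [OF k K_neq, of w "w ?K"] later_below_step [of w ?K "w ?K"]
    by (simp add: v_K del: o_apply)
  have "?inv ?v ?K = int (card (insert (?K + 1) (later_below ?v (?K + 1) (w (?K + 1)))))"
    using up later_below_step [of ?v ?K "w (?K + 1)"] by (simp add: v_K del: o_apply)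
  also have "\<dots> = 1 + int (card (later_below ?v (?K + 1) (w (?K + 1))))"
  proof (subst card_insert_disjoint)
    show "finite (later_below ?v (?K + 1) (w (?K + 1)))"
      using finite_later_below [OF _ v] n_ge_2 by simp
    show "?K + 1 \<notin> later_below ?v (?K + 1) (w (?K + 1))" by (simp add: later_below_def)
  qed simp
  finally have at_K: "?inv ?v ?K = ?inv w (?K + 1) + 1"
    using card_later_below_sref [OF k K_neq] by simp
  have "?inv ?v i = ?inv w i" if i: "i \<in> {?K + 2..<?K + int n}" for i
    using card_later_below_sref [OF k, of i] mod_eq_window_iff [OF k, of i]
      sref_fixes_window_interior [OF k i] i
    by simp
  then have "int (aff_inversions n ?v) = int (aff_inversions n w) + 1"
    unfolding aff_inversions_window [OF w, of ?K] aff_inversions_window [OF v, of ?K] window_split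
    using at_K at_Suc by simp
  then show ?thesis by linarith
qed

lemma affine_perm_sref:
  assumes k: "k < n" and w: "affine_perm n w"
  shows "affine_perm n (w \<circ> sref n k)"
proof -
  have "(\<Sum>i\<in>{int k..<int k + int n}. w (sref n k i) - i) = (\<Sum>i\<in>{int k..<int k + int n}. w i - i)"
    unfolding window_split
    by (simp add: sref_self [OF k] sref_self_Suc [OF k])
      (simp add: sref_fixes_window_interior [OF k])
  then show ?thesis using w bij_sref [OF k] shift_equivariant_sref [of w k]
    unfolding affine_perm_iff [of _ _ "int k"] by (simp add: bij_comp)
qed

lemma affine_perm_word_prod: "set ws \<subseteq> {0..<n} \<Longrightarrow> affine_perm n (word_prod n ws)"
  by (induction ws rule: rev_induct)
    (auto simp: word_prod_Nil affine_perm_id word_prod_snoc affine_perm_sref)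

lemma aff_inversions_sref_down:
  assumes k: "k < n" and w: "affine_perm n w" and down: "w (int k + 1) < w (int k)"
  shows "aff_inversions n w = aff_inversions n (w \<circ> sref n k) + 1"
proof -
  have "aff_inversions n ((w \<circ> sref n k) \<circ> sref n k) = aff_inversions n (w \<circ> sref n k) + 1"
    using down affine_perm_equivariant [OF affine_perm_sref [OF k w]]
    by (intro aff_inversions_sref_up k) (simp_all add: sref_self [OF k] sref_self_Suc [OF k])
  moreover have "(w \<circ> sref n k) \<circ> sref n k = w" by (simp add: comp_assoc sref_comp_sref [OF k])
  ultimately show ?thesis by simp
qed

lemma affine_perm_ascent_or_descent:
  assumes "affine_perm n w"
  obtains (ascent) "w i < w (i + 1)" | (descent) "w (i + 1) < w i"
  using affine_perm_neq [OF assms, of i "i + 1"] by (auto simp: linorder_neq_iff)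

lemma aff_inversions_sref_le:
  assumes "k < n" "affine_perm n w"
  shows "aff_inversions n (w \<circ> sref n k) \<le> aff_inversions n w + 1"
  using assms aff_inversions_sref_up [of k w] aff_inversions_sref_down [of k w]
    affine_perm_equivariant [of n w]
  by (cases rule: affine_perm_ascent_or_descent [OF assms(2), of "int k"]) auto

lemma aff_inversions_comp_word_prod_le:
  assumes "set ws \<subseteq> {0..<n}" "affine_perm n w"
  shows "aff_inversions n (w \<circ> word_prod n ws) \<le> aff_inversions n w + length ws"
  using assms
proof (induction ws arbitrary: w)
  case (Cons k ws)
  then have k: "k < n" by simp
  have "aff_inversions n ((w \<circ> sref n k) \<circ> word_prod n ws) \<le> aff_inversions n (w \<circ> sref n k) + length ws"
    using Cons.prems by (intro Cons.IH affine_perm_sref [OF k]) simp_all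
  then show ?case using aff_inversions_sref_le [OF k Cons.prems(2)]
    by (simp add: word_prod_Cons comp_def)
qed (simp add: word_prod_Nil)

lemma aff_inversions_word_prod_le: "set ws \<subseteq> {0..<n} \<Longrightarrow> aff_inversions n (word_prod n ws) \<le> length ws"
  using aff_inversions_comp_word_prod_le [of ws id] by (simp add: affine_perm_id aff_inversions_id)

lemma ascents_everywhere:
  assumes w: "affine_perm n w" and asc: "\<And>k. k < n \<Longrightarrow> w (int k) < w (int k + 1)"
  shows "w i < w (i + 1)"
proof -
  have "w (int (nat (i mod int n))) < w (int (nat (i mod int n)) + 1)"
    using n_ge_2 by (intro asc) (simp add: nat_less_iff)
  then have "w (i mod int n) < w (i mod int n + 1)" using n_ge_2 by simp
  then show ?thesis
    using shift_equivariant_mult [OF affine_perm_equivariant [OF w], of "i mod int n" "i div int n"]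
      shift_equivariant_mult [OF affine_perm_equivariant [OF w], of "i mod int n + 1" "i div int n"]
    by (simp add: algebra_simps)
qed

lemma no_descent_imp_id:
  assumes w: "affine_perm n w" and asc: "\<And>k. k < n \<Longrightarrow> w (int k) < w (int k + 1)"
  shows "w = id"
proof -
  note eqv = affine_perm_equivariant [OF w]
  have up: "w i + int m \<le> w (i + int m)" for i m
  proof (induction m)
    case (Suc m)
    then show ?case using ascents_everywhere [OF w asc, of "i + int m"] by (simp add: ac_simps)
  qed simp
  have "w (i + int m) = w i + int m" if "m \<le> n" for i m
    using up [of i m] up [of "i + int m" "n - m"] shift_equivariantD [OF eqv, of i] that
    by (simp add: of_nat_diff)
  from this [of _ 0] have const: "w i - i = w 0" if "i \<in> {0..<int n}" for i
    using that by (cases i) auto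
  have "0 = (\<Sum>i\<in>{0..<0 + int n}. w i - i)" using w affine_perm_iff by metis
  also have "\<dots> = int n * w 0" by (simp add: const)
  finally have "w 0 = 0" using n_ge_2 by simp
  then show ?thesis using const n_ge_2
    by (intro shift_equivariant_eqI [of n w id 0] eqv) (simp_all add: shift_equivariant_def)
qed

lemma sref_eq_transpose:
  assumes "k \<in> {1..<n}" "i \<in> {1..int n}"
  shows "sref n k i = transpose (int k) (int k + 1) i"
proof -
  have "i mod int n = int k \<longleftrightarrow> i = int k" using assms by (cases "i = int n") auto
  moreover have "(i - 1) mod int n = i - 1" using assms by (intro mod_pos_pos_trivial) auto
  ultimately show ?thesis using assms by (auto simp: sref_eq transpose_def)
qed

lemma fin_perm_sref:
  assumes k: "k \<in> {1..<n}" and w: "fin_perm n w"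
  shows "fin_perm n (w \<circ> sref n k)"
proof -
  have "sref n k ` {1..int n} = transpose (int k) (int k + 1) ` {1..int n}"
    using sref_eq_transpose [OF k] by (rule image_cong [OF refl])
  also have "\<dots> = {1..int n}" using k by (intro transpose_image_eq) auto
  finally have "(w \<circ> sref n k) ` {1..int n} = w ` {1..int n}" by (metis image_comp)
  then show ?thesis using w k affine_perm_sref by (simp add: fin_perm_def)
qed

lemma fin_perm_ascent_0:
  assumes "fin_perm n w"
  shows "w 0 < w 1"
proof -
  have "w 0 = w (int n) - int n"
    using shift_equivariantD [OF affine_perm_equivariant, of n w 0] assms
    by (simp add: fin_perm_def)
  moreover have "w (int n) \<in> {1..int n}" "w 1 \<in> {1..int n}"
    using assms n_ge_2 imageI [of "int n" "{1..int n}" w] imageI [of 1 "{1..int n}" w]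
    by (simp_all add: fin_perm_def)
  ultimately show ?thesis by auto
qed

lemma ex_reduced_word:
  assumes "affine_perm n w"
  shows "\<exists>ws. set ws \<subseteq> {0..<n} \<and> length ws = aff_inversions n w \<and> word_prod n ws = w \<and>
    (fin_perm n w \<longrightarrow> set ws \<subseteq> {1..<n})"
  using assms
proof (induction "aff_inversions n w" arbitrary: w rule: less_induct)
  case less
  show ?case
  proof (cases "\<exists>k<n. w (int k + 1) < w (int k)")
    case True
    then obtain k where k: "k < n" and descent: "w (int k + 1) < w (int k)" by blast
    let ?v = "w \<circ> sref n k"
    have len: "aff_inversions n w = aff_inversions n ?v + 1"
      by (rule aff_inversions_sref_down [OF k less.prems descent])
    then obtain ws where ws: "set ws \<subseteq> {0..<n}" "length ws = aff_inversions n ?v" "word_prod n ws = ?v"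
        "fin_perm n ?v \<longrightarrow> set ws \<subseteq> {1..<n}"
      using less.hyps [of ?v] affine_perm_sref [OF k less.prems] by auto
    have "word_prod n (ws @ [k]) = w"
      by (simp add: word_prod_snoc ws comp_assoc sref_comp_sref [OF k])
    moreover have "k \<in> {1..<n}" if "fin_perm n w"
      using fin_perm_ascent_0 [OF that] descent k by (cases "k = 0") auto
    ultimately show ?thesis using ws k len fin_perm_sref
      by (intro exI [of _ "ws @ [k]"]) auto
  next
    case False
    then have "w = id"
      using affine_perm_ascent_or_descent [OF less.prems]
      by (intro no_descent_imp_id [OF less.prems]) metis
    then show ?thesis by (intro exI [of _ "[]"]) (simp add: aff_inversions_id word_prod_Nil)
  qed
qed

lemma alen_eq_aff_inversions:
  assumes "affine_perm n w"
  shows "alen n w = aff_inversions n w"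
  unfolding alen_def
  by (rule Least_equality) (use ex_reduced_word [OF assms] aff_inversions_word_prod_le in blast)+

lemma affine_perm_comp:
  assumes "affine_perm n f" "affine_perm n g"
  shows "affine_perm n (f \<circ> g)"
proof -
  obtain xs ys where "set xs \<subseteq> {0..<n}" "word_prod n xs = f" "set ys \<subseteq> {0..<n}" "word_prod n ys = g"
    using ex_reduced_word assms by meson
  then show ?thesis using affine_perm_word_prod [of "xs @ ys"] by (auto simp: word_prod_append)
qed

lemma alen_comp_word_prod_le:
  assumes "affine_perm n w" "set ws \<subseteq> {0..<n}"
  shows "alen n (w \<circ> word_prod n ws) \<le> alen n w + length ws"
  using aff_inversions_comp_word_prod_le [of ws w] assms
  by (simp add: alen_eq_aff_inversions affine_perm_comp affine_perm_word_prod)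

lemma alen_comp_le:
  assumes "affine_perm n f" "affine_perm n g"
  shows "alen n (f \<circ> g) \<le> alen n f + alen n g"
proof -
  obtain ys where "set ys \<subseteq> {0..<n}" "word_prod n ys = g" "length ys = aff_inversions n g"
    using ex_reduced_word assms by meson
  then show ?thesis
    using alen_comp_word_prod_le [of f ys] assms by (simp add: alen_eq_aff_inversions)
qed

lemma alen_sref:
  assumes k: "k < n" and w: "affine_perm n w"
  shows "alen n (w \<circ> sref n k) = (if w (int k) < w (int k + 1) then alen n w + 1 else alen n w - 1)"
  using aff_inversions_sref_up [OF k, of w] aff_inversions_sref_down [OF k w]
    affine_perm_equivariant [OF w]
  by (cases rule: affine_perm_ascent_or_descent [OF w, of "int k"])
    (simp_all add: alen_eq_aff_inversions w affine_perm_sref [OF k w])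

lemma alen_id: "alen n id = 0"
  by (simp add: alen_eq_aff_inversions affine_perm_id aff_inversions_id)

lemma alen_0_imp_id:
  assumes "affine_perm n w" "alen n w = 0"
  shows "w = id"
  using ex_reduced_word [OF assms(1)] assms by (auto simp: alen_eq_aff_inversions word_prod_Nil)

definition length_additive_factorizations :: "(int \<Rightarrow> int) \<Rightarrow> ((int \<Rightarrow> int) \<times> (int \<Rightarrow> int)) set" where
  "length_additive_factorizations w =
    {(u, v). affine_perm n u \<and> affine_perm n v \<and> w = u \<circ> v \<and> alen n w = alen n u + alen n v}"

lemma finite_length_additive_factorizations: "finite (length_additive_factorizations w)"
proof -
  let ?G = "word_prod n ` {ws. set ws \<subseteq> {0..<n} \<and> length ws \<le> alen n w}"
  have "u \<in> ?G" if "affine_perm n u" "alen n u \<le> alen n w" for u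
    using ex_reduced_word [OF that(1)] that alen_eq_aff_inversions [OF that(1)] by auto
  then have "length_additive_factorizations w \<subseteq> ?G \<times> ?G"
    by (auto simp: length_additive_factorizations_def)
  moreover have "finite ?G" by (intro finite_imageI finite_lists_length_le) simp
  ultimately show ?thesis by (meson finite_SigmaI finite_subset)
qed

end

section \<open>NilCoxeter operators and the Yang-Baxter equation\<close>

definition nilcox :: "int \<Rightarrow> ((int \<Rightarrow> int) \<Rightarrow> 'a::comm_ring_1) \<Rightarrow> (int \<Rightarrow> int) \<Rightarrow> 'a" where
  "nilcox i \<phi> w = (if w i < w (i + 1) then \<phi> (w \<circ> transpose i (i + 1)) else 0)"

text \<open>The exponential of x times nilcox i, which squares to zero.\<close>

definition nilcox_exp :: "int \<Rightarrow> 'a::comm_ring_1 \<Rightarrow> ((int \<Rightarrow> int) \<Rightarrow> 'a) \<Rightarrow> (int \<Rightarrow> int) \<Rightarrow> 'a" where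
  "nilcox_exp i x \<phi> w = \<phi> w + x * nilcox i \<phi> w"

fun nilcox_row :: "int \<Rightarrow> nat \<Rightarrow> 'a::comm_ring_1 \<Rightarrow> ((int \<Rightarrow> int) \<Rightarrow> 'a) \<Rightarrow> (int \<Rightarrow> int) \<Rightarrow> 'a" where
  "nilcox_row i 0 x \<phi> = \<phi>"
| "nilcox_row i (Suc m) x \<phi> = nilcox_exp (i + int m) x (nilcox_row i m x \<phi>)"

lemma nilcox_add: "nilcox i (\<lambda>w. \<phi> w + \<psi> w) = (\<lambda>w. nilcox i \<phi> w + nilcox i \<psi> w)"
  by (auto simp: nilcox_def)

lemma nilcox_scale: "nilcox i (\<lambda>w. c * \<phi> w) = (\<lambda>w. c * nilcox i \<phi> w)"
  by (auto simp: nilcox_def)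

lemma nilcox_zero: "nilcox i (\<lambda>w. 0) = (\<lambda>w. 0)"
  by (auto simp: nilcox_def)

lemma nilcox_nilcox: "nilcox i (nilcox i \<phi>) = (\<lambda>w. 0)"
  by (auto simp: nilcox_def)

lemma nilcox_commute:
  assumes "i + 2 \<le> j"
  shows "nilcox i (nilcox j \<phi>) = nilcox j (nilcox i \<phi>)"
proof
  fix w :: "int \<Rightarrow> int"
  have "w \<circ> transpose i (i + 1) \<circ> transpose j (j + 1) = w \<circ> transpose j (j + 1) \<circ> transpose i (i + 1)"
    using assms by (auto simp: fun_eq_iff transpose_def)
  then show "nilcox i (nilcox j \<phi>) w = nilcox j (nilcox i \<phi>) w"
    using assms by (simp add: nilcox_def)
qed

lemma nilcox_braid:
  "nilcox (i + 1) (nilcox i (nilcox (i + 1) \<phi>)) = nilcox i (nilcox (i + 1) (nilcox i \<phi>))"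
proof
  fix w :: "int \<Rightarrow> int"
  let ?s = "transpose i (i + 1)" and ?t = "transpose (i + 1) (i + 2)"
  have "w \<circ> ?t \<circ> ?s \<circ> ?t = w \<circ> ?s \<circ> ?t \<circ> ?s"
    by (auto simp: fun_eq_iff transpose_def)
  then show "nilcox (i + 1) (nilcox i (nilcox (i + 1) \<phi>)) w = nilcox i (nilcox (i + 1) (nilcox i \<phi>)) w"
    by (auto simp: nilcox_def add.assoc)
qed

lemma nilcox_exp_lincomb:
  "nilcox_exp i x (\<lambda>w. \<phi> w + c * \<psi> w) = (\<lambda>w. nilcox_exp i x \<phi> w + c * nilcox_exp i x \<psi> w)"
  by (simp add: nilcox_exp_def [abs_def] nilcox_add nilcox_scale algebra_simps)

lemma nilcox_exp_add: "nilcox_exp i x (nilcox_exp i y \<phi>) = nilcox_exp i (x + y) \<phi>"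
  by (simp add: nilcox_exp_def [abs_def] nilcox_add nilcox_scale nilcox_nilcox algebra_simps)

lemma nilcox_exp_commute:
  assumes "i + 2 \<le> j \<or> j + 2 \<le> i"
  shows "nilcox_exp i x (nilcox_exp j y \<phi>) = nilcox_exp j y (nilcox_exp i x \<phi>)"
  using assms nilcox_commute [of i j \<phi>] nilcox_commute [of j i \<phi>]
  by (auto simp: nilcox_exp_def [abs_def] nilcox_add nilcox_scale algebra_simps)

lemma nilcox_exp_yang_baxter:
  "nilcox_exp (i + 1) x (nilcox_exp i (x + y) (nilcox_exp (i + 1) y \<phi>)) =
   nilcox_exp i y (nilcox_exp (i + 1) (x + y) (nilcox_exp i x \<phi>))"
  by (simp add: nilcox_exp_def [abs_def] nilcox_add nilcox_scale nilcox_nilcox nilcox_braid nilcox_zero)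
    (simp add: algebra_simps)

lemma nilcox_row_exp_commute:
  assumes "j + 2 \<le> i \<or> i + int m < j"
  shows "nilcox_row i m x (nilcox_exp j y \<phi>) = nilcox_exp j y (nilcox_row i m x \<phi>)"
  using assms
proof (induction m)
  case (Suc m)
  then show ?case using nilcox_exp_commute [of "i + int m" j x y "nilcox_row i m x \<phi>"] by auto
qed simp

lemma nilcox_row_exchange:
  "nilcox_exp (i + int m) (x - y) (nilcox_row i m x (nilcox_row (i + 1) m y \<phi>)) =
   nilcox_row i m y (nilcox_row (i + 1) m x (nilcox_exp i (x - y) \<phi>))"
proof (induction m)
  case (Suc m)
  let ?k = "i + int m"
  have commute: "nilcox_row i m a (nilcox_exp (?k + 1) b \<psi>) = nilcox_exp (?k + 1) b (nilcox_row i m a \<psi>)"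
    for a b \<psi>
    by (rule nilcox_row_exp_commute) simp
  have k: "i + int (Suc m) = ?k + 1" "i + 1 + int m = ?k + 1" by simp_all
  let ?\<psi> = "nilcox_row i m x (nilcox_row (i + 1) m y \<phi>)"
  have "nilcox_exp (?k + 1) (x - y) (nilcox_exp ?k ((x - y) + y) (nilcox_exp (?k + 1) y ?\<psi>)) =
    nilcox_exp ?k y (nilcox_exp (?k + 1) ((x - y) + y) (nilcox_exp ?k (x - y) ?\<psi>))"
    by (rule nilcox_exp_yang_baxter)
  then show ?case unfolding nilcox_row.simps k commute Suc.IH by simp
qed simp

lemma nilcox_row_lincomb:
  "nilcox_row i m x (\<lambda>w. \<phi> w + c * \<psi> w) = (\<lambda>w. nilcox_row i m x \<phi> w + c * nilcox_row i m x \<psi> w)"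
  by (induction m) (simp_all add: nilcox_exp_lincomb)

lemma nilcox_row_guard:
  assumes "j < i"
  shows "nilcox_row i m x (\<lambda>w. if w j = p then \<phi> w else 0) =
    (\<lambda>w. if w j = p then nilcox_row i m x \<phi> w else 0)"
proof (induction m)
  case (Suc m)
  have "transpose (i + int m) (i + int m + 1) j = j" using assms by simp
  then show ?case by (auto simp: Suc fun_eq_iff nilcox_exp_def nilcox_def)
qed (simp add: fun_eq_iff)

lemma nilcox_row_update_below:
  assumes "j < i" and \<phi>: "\<And>w. \<phi> (w(j := p)) = \<phi> w"
  shows "nilcox_row i m x \<phi> (w(j := p)) = nilcox_row i m x \<phi> w"
proof (induction m arbitrary: w)
  case (Suc m)
  let ?t = "transpose (i + int m) (i + int m + 1)"
  have "(w(j := p)) (i + int m) = w (i + int m)" "(w(j := p)) (i + int m + 1) = w (i + int m + 1)"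
    "w(j := p) \<circ> ?t = (w \<circ> ?t)(j := p)"
    using assms(1) by (auto simp: fun_eq_iff transpose_def)
  then show ?case by (simp only: nilcox_row.simps nilcox_exp_def nilcox_def Suc.IH)
qed (simp add: \<phi>)

definition delta_on :: "int set \<Rightarrow> (int \<Rightarrow> int) \<Rightarrow> (int \<Rightarrow> int) \<Rightarrow> 'a::comm_ring_1" where
  "delta_on S v w = (if \<forall>k\<in>S. w k = v k then 1 else 0)"

lemma delta_on_insert: "delta_on (insert j S) v = (\<lambda>w. if w j = v j then delta_on S v w else 0)"
  by (auto simp: delta_on_def)

lemma delta_on_cong: "(\<And>k. k \<in> S \<Longrightarrow> u k = v k) \<Longrightarrow> delta_on S u = delta_on S v"
  by (auto simp: delta_on_def fun_eq_iff)

lemma nilcox_delta_on: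
  assumes "i \<in> S" "i + 1 \<in> S"
  shows "nilcox i (delta_on S v) =
    (if v (i + 1) < v i then delta_on S (v \<circ> transpose i (i + 1)) else (\<lambda>w. 0))"
proof
  fix w :: "int \<Rightarrow> int"
  let ?t = "transpose i (i + 1)"
  have "?t ` S = S" using assms by (intro transpose_image_eq) simp
  then have reindex: "(\<forall>k\<in>S. w (?t k) = v k) \<longleftrightarrow> (\<forall>k\<in>S. w k = v (?t k))"
    by (metis image_iff transpose_involutory)
  have "w i = v (i + 1) \<and> w (i + 1) = v i" if "\<forall>k\<in>S. w k = v (?t k)"
    using that assms by simp
  then show "nilcox i (delta_on S v) w =
      (if v (i + 1) < v i then delta_on S (v \<circ> ?t) else (\<lambda>w. 0)) w"
    by (auto simp: nilcox_def delta_on_def reindex)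
qed

section \<open>Block cycles\<close>

text \<open>The first integer from k on outside A, where the block through k ends; meaningless if there is
  none.\<close>

definition block_end :: "int set \<Rightarrow> int \<Rightarrow> int" where
  "block_end A k = k + int (LEAST d. k + int d \<notin> A)"

definition block_cycle :: "int set \<Rightarrow> int \<Rightarrow> int" where
  "block_cycle A k = (if k - 1 \<in> A then k - 1 else block_end A k)"

definition gappy :: "int set \<Rightarrow> bool" where
  "gappy A \<longleftrightarrow> (\<forall>k. \<exists>j\<ge>k. j \<notin> A)"

definition ascending :: "(int \<Rightarrow> int) \<Rightarrow> int set \<Rightarrow> bool" where
  "ascending w A \<longleftrightarrow> (\<forall>k\<in>A. w k < w (block_end A k))"

definition adj_swap :: "int set \<Rightarrow> int \<Rightarrow> int" where
  "adj_swap K i = (if i \<in> K then i + 1 else if i - 1 \<in> K then i - 1 else i)"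

lemma adj_swap_singleton: "adj_swap {i} = transpose i (i + 1)"
  by (auto simp: fun_eq_iff adj_swap_def transpose_def)

lemma gappy_bounded: "A \<subseteq> {..<b} \<Longrightarrow> gappy A"
  unfolding gappy_def by (metis lessThan_iff linorder_not_le max.cobounded1 max.cobounded2 subsetD)

lemma block_end_ge: "k \<le> block_end A k"
  by (simp add: block_end_def)

lemma block_end_eqI:
  assumes "k \<le> j" "j \<notin> A" "\<And>i. k \<le> i \<Longrightarrow> i < j \<Longrightarrow> i \<in> A"
  shows "block_end A k = j"
proof -
  have "nat (j - k) \<le> d" if "k + int d \<notin> A" for d
    using assms(3) [of "k + int d"] that by fastforce
  then have "(LEAST d. k + int d \<notin> A) = nat (j - k)"
    using assms(1,2) by (intro Least_equality) simp_all
  then show ?thesis using assms(1) by (simp add: block_end_def)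
qed

lemma block_end_notin:
  assumes "gappy A"
  shows "block_end A k \<notin> A"
proof -
  obtain j where "j \<ge> k" "j \<notin> A" using assms by (auto simp: gappy_def)
  then have "k + int (nat (j - k)) \<notin> A" by simp
  then show ?thesis unfolding block_end_def by (rule LeastI)
qed

lemma mem_if_less_block_end: "k \<le> i \<Longrightarrow> i < block_end A k \<Longrightarrow> i \<in> A"
  using not_less_Least [of "nat (i - k)" "\<lambda>d. k + int d \<notin> A"] by (simp add: block_end_def)

lemma block_end_le: "k \<le> j \<Longrightarrow> j \<notin> A \<Longrightarrow> block_end A k \<le> j"
  using mem_if_less_block_end by force

lemma block_end_outside: "k \<notin> A \<Longrightarrow> block_end A k = k"
  by (rule block_end_eqI) auto

lemma block_end_eq_if_between:
  assumes "gappy A" "k \<le> i" "i \<le> block_end A k"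
  shows "block_end A i = block_end A k"
  using assms block_end_notin [of A k] mem_if_less_block_end [of k _ A] by (intro block_end_eqI) auto

lemma block_end_Int_atLeastLessThan:
  assumes "gappy A" "a \<le> k" "k \<le> b"
  shows "block_end (A \<inter> {a..<b}) k = min (block_end A k) b"
  using assms block_end_ge [of k A] block_end_notin [of A k] mem_if_less_block_end [of k _ A]
  by (intro block_end_eqI) auto

lemma block_cycle_empty: "block_cycle {} = id"
  by (auto simp: block_cycle_def block_end_outside)

lemma block_end_atLeastLessThan: "i \<le> j \<Longrightarrow> block_end {i..<j} i = j"
  by (rule block_end_eqI) auto

lemma block_cycle_atLeastLessThan:
  assumes "i \<le> j"
  shows "block_cycle {i..<j} k = (if k = i then j else if i < k \<and> k \<le> j then k - 1 else k)"
  using block_end_atLeastLessThan [OF assms] by (auto simp: block_cycle_def block_end_outside)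

text \<open>Adding K to A prolongs every block of A by at most one site, at its end.\<close>

definition addable :: "int set \<Rightarrow> int set \<Rightarrow> bool" where
  "addable A K \<longleftrightarrow> gappy A \<and> (\<forall>i\<in>K. i \<notin> A \<and> i + 1 \<notin> A \<and> i + 1 \<notin> K)"

lemma addable_gappy: "addable A K \<Longrightarrow> gappy A"
  by (simp add: addable_def)

lemma addableD: "addable A K \<Longrightarrow> i \<in> K \<Longrightarrow> i \<notin> A \<and> i + 1 \<notin> A \<and> i + 1 \<notin> K"
  by (simp add: addable_def)

lemma block_end_Un:
  assumes add: "addable A K" and k: "k - 1 \<notin> K"
  shows "block_end (A \<union> K) k = adj_swap K (block_end A k)"
proof -
  let ?j = "block_end A k"
  have j: "k \<le> ?j" "?j \<notin> A" using block_end_ge block_end_notin [OF addable_gappy [OF add]] by auto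
  have prev: "?j - 1 \<notin> K"
  proof (cases "?j = k")
    case False
    then have "?j - 1 \<in> A" using j by (intro mem_if_less_block_end [of k]) auto
    then show ?thesis using addableD [OF add] by fastforce
  qed (use k in simp)
  show ?thesis
  proof (cases "?j \<in> K")
    case True
    have "block_end (A \<union> K) k = ?j + 1"
    proof (rule block_end_eqI)
      fix i assume "k \<le> i" "i < ?j + 1"
      then show "i \<in> A \<union> K" using True mem_if_less_block_end [of k i A] by (cases "i = ?j") auto
    qed (use j addableD [OF add True] True in auto)
    then show ?thesis using True by (simp add: adj_swap_def)
  next
    case False
    have "block_end (A \<union> K) k = ?j"
      by (rule block_end_eqI) (use False j mem_if_less_block_end [of k _ A] in auto)
    then show ?thesis using False prev by (simp add: adj_swap_def)
  qed
qed

lemma block_cycle_Un: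
  assumes add: "addable A K"
  shows "block_cycle (A \<union> K) = adj_swap K \<circ> block_cycle A"
proof
  fix k
  consider (A) "k - 1 \<in> A" | (K) "k - 1 \<in> K" | (outside) "k - 1 \<notin> A \<union> K" by auto
  then show "block_cycle (A \<union> K) k = (adj_swap K \<circ> block_cycle A) k"
  proof cases
    case A
    then have "k - 1 \<notin> K" "k - 1 - 1 \<notin> K"
      using addableD [OF add, of "k - 1"] addableD [OF add, of "k - 1 - 1"] by auto
    then show ?thesis using A by (simp add: block_cycle_def adj_swap_def)
  next
    case K
    then have "k - 1 \<notin> A" "k \<notin> A" "k \<notin> K" using addableD [OF add, of "k - 1"] by auto
    then show ?thesis using K by (simp add: block_cycle_def adj_swap_def block_end_outside)
  next
    case outside
    then show ?thesis using block_end_Un [OF assms, of k] by (simp add: block_cycle_def)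
  qed
qed

lemma ascending_Un:
  assumes add: "addable A K"
  shows "ascending w (A \<union> K) \<longleftrightarrow> (\<forall>k\<in>K. w k < w (k + 1)) \<and> ascending (w \<circ> adj_swap K) A"
proof -
  have K: "block_end (A \<union> K) k = k + 1" if "k \<in> K" for k
    using that addableD [OF add that] by (intro block_end_eqI) (auto simp: order_le_less)
  have A: "block_end (A \<union> K) k = adj_swap K (block_end A k)" "adj_swap K k = k" if "k \<in> A" for k
  proof -
    have "k - 1 \<notin> K" "k \<notin> K" using that addableD [OF add, of "k - 1"] addableD [OF add, of k] by auto
    then show "block_end (A \<union> K) k = adj_swap K (block_end A k)" "adj_swap K k = k"
      using block_end_Un [OF assms, of k] by (simp_all add: adj_swap_def)
  qed
  show ?thesis unfolding ascending_def ball_Un by (auto simp: K A)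
qed

lemma block_cycle_insert_above:
  assumes "A \<subseteq> {..<a}"
  shows "block_cycle (insert a A) = transpose a (a + 1) \<circ> block_cycle A"
    and "ascending w (insert a A) \<longleftrightarrow> w a < w (a + 1) \<and> ascending (w \<circ> transpose a (a + 1)) A"
proof -
  have "addable A {a}" using gappy_bounded [OF assms] assms by (auto simp: addable_def)
  from block_cycle_Un [OF this] ascending_Un [OF this]
  show "block_cycle (insert a A) = transpose a (a + 1) \<circ> block_cycle A"
    "ascending w (insert a A) \<longleftrightarrow> w a < w (a + 1) \<and> ascending (w \<circ> transpose a (a + 1)) A"
    by (auto simp: adj_swap_singleton)
qed

lemma sum_Pow_insert:
  assumes "finite S" "a \<notin> S"
  shows "(\<Sum>A\<in>Pow (insert a S). f A) = (\<Sum>A\<in>Pow S. f A) + (\<Sum>A\<in>Pow S. f (insert a A))"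
proof -
  have "inj_on (insert a) (Pow S)"
    using assms(2) by (intro inj_onI) (metis PowD insert_ident subsetD)
  moreover have "Pow S \<inter> insert a ` Pow S = {}" using assms(2) by auto
  ultimately show ?thesis
    unfolding Pow_insert using assms(1) by (simp add: sum.union_disjoint sum.reindex)
qed

text \<open>A carrier starts at i + m with the value found there and moves down to i. At the sites in A it
  keeps its value and pushes the value it meets one place up; at the other sites it takes over that
  value.\<close>

lemma nilcox_row_expand:
  "nilcox_row i m x \<phi> w =
    (\<Sum>A\<in>Pow {i..<i + int m}. if ascending w A then x ^ card A * \<phi> (w \<circ> block_cycle A) else 0)"
proof (induction m arbitrary: w)
  case 0
  show ?case by (simp add: ascending_def block_cycle_empty)
next
  case (Suc m)
  let ?a = "i + int m" and ?S = "{i..<i + int m}"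
  let ?t = "transpose ?a (?a + 1)"
  let ?f = "\<lambda>w A. if ascending w A then x ^ card A * \<phi> (w \<circ> block_cycle A) else 0"
  have insert: "?f w (insert ?a A) = (if w ?a < w (?a + 1) then x * ?f (w \<circ> ?t) A else 0)"
    if "A \<in> Pow ?S" for A
  proof -
    have "A \<subseteq> {..<?a}" "?a \<notin> A" "finite A" using that finite_subset [of A ?S] by auto
    then show ?thesis using block_cycle_insert_above [of A ?a]
      by (simp add: comp_assoc mult.assoc)
  qed
  have "(\<Sum>A\<in>Pow (insert ?a ?S). ?f w A) =
      (\<Sum>A\<in>Pow ?S. ?f w A) + (\<Sum>A\<in>Pow ?S. if w ?a < w (?a + 1) then x * ?f (w \<circ> ?t) A else 0)"
    using insert by (simp add: sum_Pow_insert del: Pow_iff)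
  also have "\<dots> = nilcox_exp ?a x (nilcox_row i m x \<phi>) w"
    by (simp add: nilcox_exp_def nilcox_def Suc.IH [of w] Suc.IH [of "w \<circ> ?t"] sum_distrib_left
        del: o_apply)
  also have "insert ?a ?S = {i..<i + int (Suc m)}" by auto
  finally show ?case by simp
qed

lemma nilcox_row_carry_max:
  assumes support: "\<And>v. v i \<noteq> w (i + int m) \<Longrightarrow> \<phi> v = 0"
    and max: "\<And>k. i \<le> k \<Longrightarrow> k < i + int m \<Longrightarrow> w k < w (i + int m)"
  shows "nilcox_row i m x \<phi> w = x ^ m * \<phi> (w \<circ> block_cycle {i..<i + int m})"
proof -
  let ?S = "{i..<i + int m}"
  let ?f = "\<lambda>A. if ascending w A then x ^ card A * \<phi> (w \<circ> block_cycle A) else 0"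
  have "?f A = 0" if A: "A \<in> Pow ?S - {?S}" for A
  proof -
    obtain j where j: "j \<in> ?S" "j \<notin> A" using A by blast
    then have "block_end A i < i + int m" using block_end_le [of i j A] by auto
    then have "w (block_cycle A i) \<noteq> w (i + int m)"
      using max [of "block_end A i"] block_end_ge [of i A] A by (auto simp: block_cycle_def)
    then show ?thesis using support [of "w \<circ> block_cycle A"] by simp
  qed
  then have "(\<Sum>A\<in>Pow ?S. ?f A) = (\<Sum>A\<in>{?S}. ?f A)"
    by (intro sum.mono_neutral_right) auto
  moreover have "ascending w ?S"
  proof -
    have "block_end ?S k = i + int m" if "k \<in> ?S" for k
      using that by (intro block_end_eqI) auto
    then show ?thesis using max by (auto simp: ascending_def)
  qed
  ultimately show ?thesis unfolding nilcox_row_expand by simp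
qed

section \<open>Schubert polynomials\<close>

fun nilcox_stairs :: "nat \<Rightarrow> (nat \<Rightarrow> 'a::comm_ring_1) \<Rightarrow> nat \<Rightarrow> ((int \<Rightarrow> int) \<Rightarrow> 'a) \<Rightarrow> (int \<Rightarrow> int) \<Rightarrow> 'a" where
  "nilcox_stairs n \<xi> 0 \<phi> = \<phi>"
| "nilcox_stairs n \<xi> (Suc m) \<phi> =
    nilcox_row (int n - int (Suc m)) (Suc m) (\<xi> (n - Suc m)) (nilcox_stairs n \<xi> m \<phi>)"

lemma nilcox_stairs_lincomb:
  "nilcox_stairs n \<xi> m (\<lambda>w. \<phi> w + c * \<psi> w) = (\<lambda>w. nilcox_stairs n \<xi> m \<phi> w + c * nilcox_stairs n \<xi> m \<psi> w)"
  by (induction m) (simp_all add: nilcox_row_lincomb del: nilcox_row.simps)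

lemma nilcox_stairs_zero: "nilcox_stairs n \<xi> m (\<lambda>w. 0) = (\<lambda>w. 0)"
  using nilcox_stairs_lincomb [of n \<xi> m "\<lambda>w. 0" 1 "\<lambda>w. 0"] by (simp add: fun_eq_iff)

lemma nilcox_stairs_cong:
  assumes "\<And>j. n - m \<le> j \<Longrightarrow> j < n \<Longrightarrow> \<xi> j = \<xi>' j" "m \<le> n"
  shows "nilcox_stairs n \<xi> m = nilcox_stairs n \<xi>' m"
proof
  show "nilcox_stairs n \<xi> m \<phi> = nilcox_stairs n \<xi>' m \<phi>" for \<phi>
    using assms by (induction m) (simp_all del: nilcox_row.simps)
qed

lemma nilcox_stairs_exp_commute:
  assumes "j + 2 + int m \<le> int n"
  shows "nilcox_stairs n \<xi> m (nilcox_exp j y \<phi>) = nilcox_exp j y (nilcox_stairs n \<xi> m \<phi>)"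
  using assms by (induction m) (simp_all add: nilcox_row_exp_commute del: nilcox_row.simps)

lemma nilcox_stairs_guard:
  assumes "j + int m < int n"
  shows "nilcox_stairs n \<xi> m (\<lambda>w. if w j = p then \<phi> w else 0) =
    (\<lambda>w. if w j = p then nilcox_stairs n \<xi> m \<phi> w else 0)"
  using assms
proof (induction m)
  case (Suc m)
  then have "j < int n - int (Suc m)" by simp
  with Suc show ?case unfolding nilcox_stairs.simps by (simp only: nilcox_row_guard)
qed (simp add: fun_eq_iff)

lemma nilcox_stairs_delta_on_eq_0:
  assumes "j \<in> S" "j + int m < int n" "w j \<noteq> v j"
  shows "nilcox_stairs n \<xi> m (delta_on S v) w = 0"
proof -
  have "delta_on S v = (\<lambda>w. if w j = v j then delta_on S v w else 0)"
    using delta_on_insert [of j S v] unfolding insert_absorb [OF assms(1)] .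
  then have "nilcox_stairs n \<xi> m (delta_on S v) w =
      nilcox_stairs n \<xi> m (\<lambda>w. if w j = v j then delta_on S v w else 0) w"
    by (rule arg_cong)
  also have "\<dots> = 0" using assms(3) by (simp add: nilcox_stairs_guard [OF assms(2)])
  finally show ?thesis .
qed

lemma swapnat_eq_transpose: "swapnat i = transpose i (i + 1)"
  by (auto simp: fun_eq_iff swapnat_def transpose_def)

lemma nilcox_stairs_exchange_last:
  fixes \<xi> :: "nat \<Rightarrow> 'a::comm_ring_1"
  assumes m: "m < n" and i: "i = n - Suc m"
  shows "nilcox_stairs n \<xi> (Suc m) \<phi> =
    nilcox_stairs n (\<xi> \<circ> swapnat i) (Suc m) (nilcox_exp (int i) (\<xi> i - \<xi> (i + 1)) \<phi>)"
proof -
  have bottom: "int n - int (Suc m) = int i" using m i by simp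
  have next_row: "nilcox_stairs n \<zeta> m \<psi> =
      nilcox_row (int i + 1) m (\<zeta> (i + 1)) (nilcox_stairs n \<zeta> (m - 1) \<psi>)"
    for \<zeta> :: "nat \<Rightarrow> 'a" and \<psi>
  proof (cases m)
    case (Suc k)
    then have "int n - int (Suc k) = int i + 1" "n - Suc k = i + 1" using i m by auto
    then show ?thesis unfolding Suc by (simp only: nilcox_stairs.simps diff_Suc_1)
  qed simp
  let ?x = "\<xi> i" and ?y = "\<xi> (i + 1)"
  let ?\<psi> = "nilcox_stairs n \<xi> (m - 1) \<phi>"
  have rest: "nilcox_stairs n (\<xi> \<circ> swapnat i) (m - 1) (nilcox_exp (int i) (?x - ?y) \<phi>) =
      nilcox_exp (int i) (?x - ?y) ?\<psi>"
  proof (cases m)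
    case (Suc k)
    have "nilcox_stairs n (\<xi> \<circ> swapnat i) (m - 1) = nilcox_stairs n \<xi> (m - 1)"
      by (rule nilcox_stairs_cong) (use Suc m i in \<open>auto simp: swapnat_def\<close>)
    then show ?thesis using Suc i m by (simp add: nilcox_stairs_exp_commute)
  qed simp
  have "nilcox_stairs n \<xi> (Suc m) \<phi> = nilcox_exp (int i + int m) (?y + (?x - ?y))
      (nilcox_row (int i) m ?x (nilcox_row (int i + 1) m ?y ?\<psi>))"
    by (simp only: nilcox_stairs.simps bottom i [symmetric] next_row nilcox_row.simps) simp
  also have "\<dots> = nilcox_exp (int i + int m) ?y
      (nilcox_row (int i) m ?y (nilcox_row (int i + 1) m ?x (nilcox_exp (int i) (?x - ?y) ?\<psi>)))"
    unfolding nilcox_exp_add [symmetric] nilcox_row_exchange ..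
  also have "\<dots> = nilcox_stairs n (\<xi> \<circ> swapnat i) (Suc m) (nilcox_exp (int i) (?x - ?y) \<phi>)"
    unfolding nilcox_stairs.simps bottom i [symmetric] next_row rest by (simp add: swapnat_def)
  finally show ?thesis .
qed

lemma nilcox_stairs_exchange:
  fixes \<xi> :: "nat \<Rightarrow> 'a::comm_ring_1"
  assumes "i < n" "n \<le> i + m" "m \<le> n"
  shows "nilcox_stairs n \<xi> m \<phi> =
    nilcox_stairs n (\<xi> \<circ> swapnat i) m (nilcox_exp (int i) (\<xi> i - \<xi> (i + 1)) \<phi>)"
  using assms(2,3)
proof (induction m)
  case (Suc m)
  show ?case
  proof (cases "n \<le> i + m")
    case True
    then have "n - Suc m < i" using Suc.prems assms(1) by linarith
    then have "swapnat i (n - Suc m) = n - Suc m" by (simp add: swapnat_def)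
    then show ?thesis using True Suc by (simp del: nilcox_row.simps)
  next
    case False
    then have "i = n - Suc m" "m < n" using Suc.prems by auto
    then show ?thesis by (intro nilcox_stairs_exchange_last)
  qed
qed (use assms(1) in simp)

lemma nilcox_stairs_divided_difference:
  fixes \<xi> :: "nat \<Rightarrow> 'a::comm_ring_1"
  assumes "i < n" "n \<le> i + m" "m \<le> n"
  shows "nilcox_stairs n \<xi> m \<phi> w - nilcox_stairs n (\<xi> \<circ> swapnat i) m \<phi> w =
    (\<xi> i - \<xi> (i + 1)) * nilcox_stairs n \<xi> m (nilcox (int i) \<phi>) w"
proof -
  have "nilcox_stairs n \<xi> m (nilcox (int i) \<phi>) = nilcox_stairs n (\<xi> \<circ> swapnat i) m (nilcox (int i) \<phi>)"
    using nilcox_stairs_exchange [OF assms, of \<xi> "nilcox (int i) \<phi>"]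
    by (simp add: nilcox_exp_def [abs_def] nilcox_nilcox)
  moreover have "nilcox_stairs n \<xi> m \<phi> w = nilcox_stairs n (\<xi> \<circ> swapnat i) m \<phi> w +
      (\<xi> i - \<xi> (i + 1)) * nilcox_stairs n (\<xi> \<circ> swapnat i) m (nilcox (int i) \<phi>) w"
    using nilcox_stairs_exchange [OF assms, of \<xi> \<phi>]
    by (simp add: nilcox_exp_def [abs_def] nilcox_stairs_lincomb)
  ultimately show ?thesis by simp
qed

lemma nilcox_stairs_hom:
  fixes \<sigma> :: "'a::comm_ring_1 \<Rightarrow> 'b::comm_ring_1"
  assumes "\<And>a b. \<sigma> (a + b) = \<sigma> a + \<sigma> b" "\<And>a b. \<sigma> (a * b) = \<sigma> a * \<sigma> b" "\<sigma> 0 = 0"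
  shows "\<sigma> (nilcox_stairs n \<xi> m \<phi> w) = nilcox_stairs n (\<sigma> \<circ> \<xi>) m (\<sigma> \<circ> \<phi>) w"
proof -
  have exp: "\<sigma> \<circ> nilcox_exp i x \<psi> = nilcox_exp i (\<sigma> x) (\<sigma> \<circ> \<psi>)" for i x \<psi>
    by (auto simp: nilcox_exp_def nilcox_def fun_eq_iff assms)
  have row: "\<sigma> \<circ> nilcox_row i k x \<psi> = nilcox_row i k (\<sigma> x) (\<sigma> \<circ> \<psi>)" for i k x \<psi>
    by (induction k) (simp_all only: nilcox_row.simps exp)
  have "\<sigma> \<circ> nilcox_stairs n \<xi> m \<phi> = nilcox_stairs n (\<sigma> \<circ> \<xi>) m (\<sigma> \<circ> \<phi>)"
    by (induction m) (simp_all only: nilcox_stairs.simps row o_apply [of \<sigma> \<xi>])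
  then show ?thesis by (metis comp_apply)
qed

lemma nilcox_stairs_closed:
  assumes "\<And>a b. P a \<Longrightarrow> P b \<Longrightarrow> P (a + b)" "\<And>a b. P a \<Longrightarrow> P b \<Longrightarrow> P (a * b)" "P 0"
    "\<And>i. P (\<xi> i)" "\<And>w. P (\<phi> w)"
  shows "P (nilcox_stairs n \<xi> m \<phi> w)"
proof -
  have exp: "P (nilcox_exp i x \<psi> w)" if "P x" "\<And>w. P (\<psi> w)" for i x \<psi> w
    using that assms(1,2,3) by (simp add: nilcox_exp_def nilcox_def)
  have row: "P (nilcox_row i k x \<psi> w)" if "P x" "\<And>w. P (\<psi> w)" for i k x \<psi> w
    using that by (induction k arbitrary: w) (simp_all add: exp)
  show ?thesis
    by (induction m arbitrary: w) (simp_all add: row assms(4,5) del: nilcox_row.simps)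
qed

lemma w0_window: "k \<in> {1..int n} \<Longrightarrow> w0 n k = int n + 1 - k"
  by (simp add: w0_def div_pos_pos_trivial)

lemma nilcox_stairs_w0:
  assumes "m < n" "\<And>k. 1 \<le> k \<Longrightarrow> k < int n - int m \<Longrightarrow> w k = int n + 1 - k"
    "\<And>k. int n - int m \<le> k \<Longrightarrow> k \<le> int n \<Longrightarrow> w k = k - (int n - int m) + 1"
  shows "nilcox_stairs n \<xi> m (delta_on {1..int n} (w0 n)) w = (\<Prod>j\<in>{n - m..<n}. \<xi> j ^ (n - j))"
  using assms
proof (induction m arbitrary: w)
  case 0
  have "w k = w0 n k" if "k \<in> {1..int n}" for k
    using w0_window [OF that] 0(2,3) [of k] that by (cases "k = int n") auto
  then show ?case by (simp add: delta_on_def)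
next
  case (Suc m)
  define i where "i = n - Suc m"
  have i: "int n - int (Suc m) = int i" "int i + int (Suc m) = int n" "1 \<le> i" "i < n" "n - i = Suc m"
    using Suc.prems(1) by (auto simp: i_def)
  let ?\<phi> = "nilcox_stairs n \<xi> m (delta_on {1..int n} (w0 n))"
  have top: "w (int i + int (Suc m)) = int n + 1 - int i" using Suc.prems(3) [of "int n"] i by simp
  have "nilcox_stairs n \<xi> (Suc m) (delta_on {1..int n} (w0 n)) w = nilcox_row (int i) (Suc m) (\<xi> i) ?\<phi> w"
    by (simp only: nilcox_stairs.simps i i_def [symmetric])
  also have "\<dots> = \<xi> i ^ Suc m * ?\<phi> (w \<circ> block_cycle {int i..<int i + int (Suc m)})"
  proof (rule nilcox_row_carry_max)
    show "?\<phi> v = 0" if "v (int i) \<noteq> w (int i + int (Suc m))" for v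
      using that i top w0_window [of "int i" n] by (intro nilcox_stairs_delta_on_eq_0 [of "int i"]) auto
    show "w k < w (int i + int (Suc m))" if "int i \<le> k" "k < int i + int (Suc m)" for k
      using that Suc.prems(3) [of k] i top by simp
  qed
  also have "?\<phi> (w \<circ> block_cycle {int i..<int i + int (Suc m)}) = (\<Prod>j\<in>{n - m..<n}. \<xi> j ^ (n - j))"
    using Suc.prems i top by (intro Suc.IH) (auto simp: block_cycle_atLeastLessThan)
  also have "{n - Suc m..<n} = insert i {n - m..<n}" using i by auto
  then have "\<xi> i ^ Suc m * (\<Prod>j\<in>{n - m..<n}. \<xi> j ^ (n - j)) = (\<Prod>j\<in>{n - Suc m..<n}. \<xi> j ^ (n - j))"
    using i by simp
  finally show ?case .
qed

lemma poly_mapping_add_induct [case_names zero single add]: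
  fixes p :: "'a \<Rightarrow>\<^sub>0 'b::monoid_add"
  assumes "P 0" "\<And>a c. P (Poly_Mapping.single a c)" "\<And>p q. P p \<Longrightarrow> P q \<Longrightarrow> P (p + q)"
  shows "P p"
proof (induction p rule: update_induct)
  case (update f a b)
  have "Poly_Mapping.update a b f = f + Poly_Mapping.single a b"
    using update(1)
    by (intro poly_mapping_eqI)
      (auto simp: lookup_update lookup_add lookup_single in_keys_iff when_def)
  then show ?case using assms update by simp
qed (rule assms)

abbreviation swapexp :: "nat \<Rightarrow> (nat \<Rightarrow>\<^sub>0 nat) \<Rightarrow> (nat \<Rightarrow>\<^sub>0 nat)" where
  "swapexp i \<equiv> Poly_Mapping.map_key (swapnat i)"

lemma inj_swapnat: "inj (swapnat i)"
  by (simp add: swapnat_eq_transpose)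

lemma swapexp_invol: "swapexp i (swapexp i a) = a"
proof -
  have "swapnat i \<circ> swapnat i = (\<lambda>x. x)" by (auto simp: swapnat_eq_transpose)
  then show ?thesis using map_key_compose [OF inj_swapnat inj_swapnat] by (metis map_key_id)
qed

lemma inj_swapexp: "inj (swapexp i)"
  by (metis injI swapexp_invol)

lemma swapv_zero: "swapv i 0 = 0"
  by (simp add: swapv_def inj_swapexp)

lemma swapv_add: "swapv i (p + q) = swapv i p + swapv i q"
  by (simp add: swapv_def map_key_plus [OF inj_swapexp])

lemma swapv_single: "swapv i (Poly_Mapping.single a c) = Poly_Mapping.single (swapexp i a) c"
  using map_key_single [OF inj_swapexp, of i "swapexp i a" c] by (simp add: swapv_def swapexp_invol)

lemma swapv_mult: "swapv i (p * q) = swapv i p * swapv i q"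
proof (induction p rule: poly_mapping_add_induct)
  case (single a c)
  show ?case
    by (induction q rule: poly_mapping_add_induct)
      (simp_all add: swapv_zero swapv_add swapv_single mult_single
        map_key_plus [OF inj_swapnat] ring_distribs)
qed (simp_all add: swapv_zero swapv_add ring_distribs)

lemma swapv_one: "swapv i 1 = 1"
  by (simp add: single_one [symmetric] swapv_single inj_swapnat del: single_one)

lemma swapv_Xvar: "swapv i (Xvar k) = Xvar (swapnat i k)"
  using map_key_single [OF inj_swapnat, of i "swapnat i k" "1::nat"]
  by (simp add: Xvar_def swapv_single swapnat_eq_transpose)

lemma Xvar_inj: "Xvar i = Xvar j \<Longrightarrow> i = j"
  unfolding Xvar_def by (metis keys_single singleton_inject zero_neq_one)

lemma ddiff_eqI:
  assumes "(Xvar i - Xvar (i + 1)) * g = f - swapv i f"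
  shows "ddiff i f = g"
  unfolding ddiff_def
proof (rule the_equality)
  fix h assume "(Xvar i - Xvar (i + 1)) * h = f - swapv i f"
  then have "(Xvar i - Xvar (i + 1)) * h = (Xvar i - Xvar (i + 1)) * g" using assms by simp
  moreover have "Xvar i - Xvar (i + 1) \<noteq> 0" using Xvar_inj [of i "i + 1"] by auto
  ultimately show "h = g" by simp
qed (rule assms)

lemma ddiff_zero: "ddiff i 0 = 0"
  by (rule ddiff_eqI) (simp add: swapv_zero)

lemma lookup_mult_nonneg:
  fixes p q :: mpoly
  assumes "\<And>a. Poly_Mapping.lookup p a \<ge> 0" "\<And>a. Poly_Mapping.lookup q a \<ge> 0"
  shows "Poly_Mapping.lookup (p * q) a \<ge> 0"
  unfolding lookup_mult Sum_any.expand_set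
  by (intro sum_nonneg mult_nonneg_nonneg assms) (simp add: when_def assms)

definition stairs_coeff :: "nat \<Rightarrow> (int \<Rightarrow> int) \<Rightarrow> mpoly" where
  "stairs_coeff n v = nilcox_stairs n Xvar (n - 1) (delta_on {1..int n} v) id"

lemma stairs_coeff_w0:
  assumes "n > 0"
  shows "stairs_coeff n (w0 n) = schub_top n"
  using nilcox_stairs_w0 [of "n - 1" n id Xvar] assms by (simp add: stairs_coeff_def schub_top_def)

lemma stairs_coeff_nonneg: "Poly_Mapping.lookup (stairs_coeff n v) a \<ge> 0"
proof -
  have "\<forall>a. Poly_Mapping.lookup (stairs_coeff n v) a \<ge> 0"
    unfolding stairs_coeff_def
    by (rule nilcox_stairs_closed [where P = "\<lambda>p. \<forall>a. Poly_Mapping.lookup p a \<ge> 0"])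
      (auto simp: lookup_add lookup_mult_nonneg Xvar_def lookup_single delta_on_def lookup_one when_def)
  then show ?thesis ..
qed

lemma ddiff_stairs_coeff:
  assumes i: "i \<in> {1..<n}"
  shows "ddiff i (stairs_coeff n v) =
    (if v (int i + 1) < v (int i) then stairs_coeff n (v \<circ> transpose (int i) (int i + 1)) else 0)"
proof (rule ddiff_eqI)
  let ?\<delta> = "delta_on {1..int n}" and ?t = "transpose (int i) (int i + 1)"
  have "swapv i (stairs_coeff n v) = nilcox_stairs n (swapv i \<circ> Xvar) (n - 1) (swapv i \<circ> ?\<delta> v) id"
    unfolding stairs_coeff_def
    by (rule nilcox_stairs_hom) (simp_all add: swapv_add swapv_mult swapv_zero)
  also have "swapv i \<circ> Xvar = Xvar \<circ> swapnat i" by (auto simp: swapv_Xvar)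
  also have "swapv i \<circ> ?\<delta> v = ?\<delta> v" by (auto simp: delta_on_def swapv_one swapv_zero)
  finally have "stairs_coeff n v - swapv i (stairs_coeff n v) =
      nilcox_stairs n Xvar (n - 1) (?\<delta> v) id - nilcox_stairs n (Xvar \<circ> swapnat i) (n - 1) (?\<delta> v) id"
    by (simp only: stairs_coeff_def)
  also have "\<dots> = (Xvar i - Xvar (i + 1)) * nilcox_stairs n Xvar (n - 1) (nilcox (int i) (?\<delta> v)) id"
    using i by (intro nilcox_stairs_divided_difference) auto
  also have "nilcox_stairs n Xvar (n - 1) (nilcox (int i) (?\<delta> v)) id =
      (if v (int i + 1) < v (int i) then stairs_coeff n (v \<circ> ?t) else 0)"
    using i by (simp add: nilcox_delta_on stairs_coeff_def nilcox_stairs_zero)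
  finally show "(Xvar i - Xvar (i + 1)) *
      (if v (int i + 1) < v (int i) then stairs_coeff n (v \<circ> ?t) else 0) =
      stairs_coeff n v - swapv i (stairs_coeff n v)" by simp
qed

lemma fold_ddiff_nonneg:
  assumes "set ws \<subseteq> {1..<n}" "p = 0 \<or> p \<in> range (stairs_coeff n)"
  shows "Poly_Mapping.lookup (fold ddiff ws p) a \<ge> 0"
  using assms
proof (induction ws arbitrary: p)
  case Nil
  then show ?case using stairs_coeff_nonneg by auto
next
  case (Cons i ws)
  then have "ddiff i p = 0 \<or> ddiff i p \<in> range (stairs_coeff n)"
    by (auto simp: ddiff_zero ddiff_stairs_coeff)
  then show ?case using Cons by simp
qed

context affine_symmetric_group
begin

lemma w0_invol: "w0 n (w0 n i) = i"
proof -
  let ?q = "(i - 1) div int n" and ?r = "(i - 1) mod int n"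
  have "w0 n i - 1 = (int n - 1 - ?r) + ?q * int n" by (simp add: w0_def)
  moreover have "0 \<le> int n - 1 - ?r" "int n - 1 - ?r < int n"
    using n_ge_2 pos_mod_bound [of "int n" "i - 1"] pos_mod_sign [of "int n" "i - 1"] by linarith+
  ultimately have "(w0 n i - 1) div int n = ?q" "(w0 n i - 1) mod int n = int n - 1 - ?r"
    using n_ge_2
    by (simp_all only: div_mult_self1 mod_mult_self1 div_pos_pos_trivial mod_pos_pos_trivial)
  then have "w0 n (w0 n i) = ?q * int n + ?r + 1" by (simp add: w0_def)
  then show ?thesis by simp
qed

lemma w0_add_period: "w0 n (i + int n) = w0 n i + int n"
proof -
  have "(i + int n - 1) div int n = (i - 1) div int n + 1"
    "(i + int n - 1) mod int n = (i - 1) mod int n"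
    using n_ge_2 div_add_self2 [of "int n" "i - 1"] mod_add_self2 [of "i - 1" "int n"]
    by (simp_all add: algebra_simps)
  then show ?thesis by (simp add: w0_def algebra_simps)
qed

lemma fin_perm_w0: "fin_perm n (w0 n)"
proof -
  have window: "bij_betw (w0 n) {1..int n} {1..int n}"
    by (rule bij_betwI [where g = "w0 n"]) (auto simp: w0_window w0_invol)
  have "w0 n \<circ> w0 n = id" by (auto simp: w0_invol)
  then have "bij (w0 n)" by (rule o_bij) fact
  moreover have "(\<Sum>i\<in>{1..int n}. w0 n i) = (\<Sum>i\<in>{1..int n}. i)"
    by (rule sum.reindex_bij_betw [OF window])
  ultimately have "affine_perm n (w0 n)"
    by (simp add: affine_perm_def w0_add_period gauss_sum_int)
  then show ?thesis using window by (simp add: fin_perm_def bij_betw_def)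
qed

lemma fin_perm_comp:
  assumes "fin_perm n u" "fin_perm n v"
  shows "fin_perm n (u \<circ> v)"
  using assms affine_perm_comp [of u v] by (metis fin_perm_def image_comp)

lemma schub_eq_fold_ddiff:
  assumes "fin_perm n v"
  obtains ws where "set ws \<subseteq> {1..<n}" "schub n v = fold ddiff ws (schub_top n)"
proof -
  let ?u = "w0 n \<circ> v"
  have u: "fin_perm n ?u" by (rule fin_perm_comp [OF fin_perm_w0 assms])
  then obtain ws where "set ws \<subseteq> {1..<n}" "word_prod n ws = ?u" "length ws = alen n ?u"
    using ex_reduced_word [of ?u] alen_eq_aff_inversions [of ?u] by (auto simp: fin_perm_def)
  then have "\<exists>p. \<exists>ws. set ws \<subseteq> {1..<n} \<and> word_prod n ws = ?u \<and> length ws = alen n ?u \<and>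
      p = fold ddiff ws (schub_top n)" by blast
  from someI_ex [OF this] obtain ws where "set ws \<subseteq> {1..<n}" "schub n v = fold ddiff ws (schub_top n)"
    unfolding schub_def by blast
  then show thesis by (rule that)
qed

lemma schub_nonneg:
  assumes "fin_perm n v"
  shows "Poly_Mapping.lookup (schub n v) a \<ge> 0"
proof -
  obtain ws where "set ws \<subseteq> {1..<n}" "schub n v = fold ddiff ws (schub_top n)"
    by (rule schub_eq_fold_ddiff [OF assms])
  moreover have "schub_top n = stairs_coeff n (w0 n)" using stairs_coeff_w0 n_ge_2 by simp
  ultimately show ?thesis by (simp add: fold_ddiff_nonneg)
qed

end

section \<open>Cyclically decreasing elements\<close>

definition periodize :: "nat \<Rightarrow> nat set \<Rightarrow> int set" where
  "periodize n A = {k. nat (k mod int n) \<in> A}"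

lemma periodize_add_mult: "k + int n * q \<in> periodize n A \<longleftrightarrow> k \<in> periodize n A"
  by (simp add: periodize_def)

lemma periodize_insert: "periodize n (insert k A) = periodize n A \<union> periodize n {k}"
  by (auto simp: periodize_def)

lemma gappy_periodize:
  assumes "A \<subset> {0..<n}"
  shows "gappy (periodize n A)"
  unfolding gappy_def
proof
  fix k
  obtain r where r: "r < n" "r \<notin> A" using psubset_imp_ex_mem [OF assms] by auto
  let ?j = "int r + int n * \<bar>k\<bar>"
  have "\<bar>k\<bar> \<le> int n * \<bar>k\<bar>" using r(1) by (intro mult_le_cancel_right1 [THEN iffD2]) auto
  then have "?j \<ge> k" by linarith
  moreover have "?j \<notin> periodize n A" using r by (simp add: periodize_def)
  ultimately show "\<exists>j\<ge>k. j \<notin> periodize n A" by blast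
qed

lemma block_end_periodize_add_mult:
  assumes "gappy (periodize n A)"
  shows "block_end (periodize n A) (k + int n * q) = block_end (periodize n A) k + int n * q"
proof (rule block_end_eqI)
  fix i assume "k + int n * q \<le> i" "i < block_end (periodize n A) k + int n * q"
  then have "i - int n * q \<in> periodize n A" by (intro mem_if_less_block_end [of k]) auto
  then show "i \<in> periodize n A" using periodize_add_mult [of "i - int n * q" n q A] by simp
qed (use block_end_ge block_end_notin [OF assms] in \<open>auto simp: periodize_add_mult\<close>)

lemma block_end_periodize_less:
  assumes "n > 0" and gap: "gappy (periodize n A)"
  shows "block_end (periodize n A) k < k + int n"
proof -
  obtain j where j: "j \<ge> k" "j \<notin> periodize n A" using gap by (auto simp: gappy_def)
  let ?r = "k + (j - k) mod int n"
  have "j = ?r + int n * ((j - k) div int n)" by simp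
  then have "?r \<notin> periodize n A" using j(2) periodize_add_mult by metis
  then have "block_end (periodize n A) k \<le> ?r" using assms(1) by (intro block_end_le) simp_all
  then show ?thesis using pos_mod_bound [of "int n" "j - k"] assms(1) by linarith
qed

lemma ascending_periodize_window:
  assumes "n > 0" and gap: "gappy (periodize n A)" and w: "shift_equivariant n w"
  shows "ascending w (periodize n A) \<longleftrightarrow>
    (\<forall>k\<in>periodize n A \<inter> {a..<a + int n}. w k < w (block_end (periodize n A) k))"
proof
  assume window: "\<forall>k\<in>periodize n A \<inter> {a..<a + int n}. w k < w (block_end (periodize n A) k)"
  show "ascending w (periodize n A)" unfolding ascending_def
  proof
    fix k assume k: "k \<in> periodize n A"
    let ?q = "(k - a) div int n" and ?r = "a + (k - a) mod int n"
    have k_decomp: "k = ?r + int n * ?q" by simp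
    have "?r \<in> periodize n A" using k periodize_add_mult [of ?r n ?q A] k_decomp by metis
    moreover have "?r \<in> {a..<a + int n}" using assms(1) by simp
    ultimately have "w ?r < w (block_end (periodize n A) ?r)" using window by blast
    then show "w k < w (block_end (periodize n A) k)"
      by (subst (1 2) k_decomp)
        (simp only: block_end_periodize_add_mult [OF gap] shift_equivariant_mult [OF w])
  qed
qed (auto simp: ascending_def)

lemma bij_betw_residues: "n > 0 \<Longrightarrow> bij_betw (\<lambda>k. nat (k mod int n)) {a..<a + int n} {0..<n}"
proof (rule bij_betwI [where g = "\<lambda>r. a + (int r - a) mod int n"])
  assume n: "n > 0"
  show "(\<lambda>k. nat (k mod int n)) \<in> {a..<a + int n} \<rightarrow> {0..<n}" using n by (auto simp: nat_less_iff)
  show "(\<lambda>r. a + (int r - a) mod int n) \<in> {0..<n} \<rightarrow> {a..<a + int n}" using n by auto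
  show "a + (int (nat (k mod int n)) - a) mod int n = k" if "k \<in> {a..<a + int n}" for k
  proof -
    have "(int (nat (k mod int n)) - a) mod int n = (k - a) mod int n"
      using n by (simp add: mod_simps)
    also have "\<dots> = k - a" using that by (intro mod_pos_pos_trivial) auto
    finally show ?thesis by simp
  qed
  show "nat ((a + (int r - a) mod int n) mod int n) = r" if "r \<in> {0..<n}" for r
    using that by (simp add: mod_simps)
qed

lemma mem_iff_block_cycle: "k \<in> A \<longleftrightarrow> block_cycle A (k + 1) = k"
  using block_end_ge [of "k + 1" A] by (auto simp: block_cycle_def)

lemma inj_on_block_cycle_periodize: "inj_on (\<lambda>A. block_cycle (periodize n A)) {A. A \<subseteq> {0..<n}}"
proof (rule inj_onI)
  fix A B assume AB: "A \<in> {A. A \<subseteq> {0..<n}}" "B \<in> {A. A \<subseteq> {0..<n}}"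
    and eq: "block_cycle (periodize n A) = block_cycle (periodize n B)"
  have "periodize n A = periodize n B" using mem_iff_block_cycle eq by (auto simp: set_eq_iff)
  moreover have "r \<in> S \<longleftrightarrow> int r \<in> periodize n S" if "r < n" for r S
    using that by (simp add: periodize_def)
  ultimately have "r \<in> A \<longleftrightarrow> r \<in> B" if "r < n" for r using that by simp
  then show "A = B" using AB by auto
qed

context affine_symmetric_group
begin

lemma in_periodize: "k \<in> periodize n A \<longleftrightarrow> (\<exists>r\<in>A. k mod int n = int r)"
proof -
  have "k mod int n \<ge> 0" using n_ge_2 by simp
  then show ?thesis unfolding periodize_def by (metis mem_Collect_eq nat_int int_nat_eq)
qed

lemma in_periodize_Suc:
  assumes "k mod int n = int r"
  shows "k + 1 \<in> periodize n A \<longleftrightarrow> (r + 1) mod n \<in> A"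
proof -
  have "(k + 1) mod int n = int ((r + 1) mod n)"
    using assms by (metis mod_add_left_eq of_nat_1 of_nat_add zmod_int)
  then show ?thesis by (auto simp: in_periodize)
qed

lemma sref_eq_adj_swap: "k < n \<Longrightarrow> sref n k = adj_swap (periodize n {k})"
  by (auto simp: fun_eq_iff sref_eq adj_swap_def in_periodize)

lemma Suc_mod_neq: "k < n \<Longrightarrow> (k + 1) mod n \<noteq> k"
  using n_ge_2 by (cases "k + 1 = n") auto

definition cyc_word :: "nat list \<Rightarrow> bool" where
  "cyc_word ws \<longleftrightarrow> set ws \<subseteq> {0..<n} \<and> distinct ws \<and>
     (\<forall>p<length ws. \<forall>q<length ws. ws ! q = (ws ! p + 1) mod n \<longrightarrow> q < p)"

lemma cyc_dec_iff_cyc_word: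
  "cyc_dec n v \<longleftrightarrow> (\<exists>ws. cyc_word ws \<and> word_prod n ws = v \<and> length ws = alen n v)"
  unfolding cyc_dec_def cyc_word_def by blast

lemma cyc_word_Nil: "cyc_word []"
  by (simp add: cyc_word_def)

lemma cyc_word_Cons:
  "cyc_word (k # ws) \<longleftrightarrow> k < n \<and> k \<notin> set ws \<and> (k + 1) mod n \<notin> set ws \<and> cyc_word ws"
  unfolding cyc_word_def using Suc_mod_neq [of k]
  by (auto simp: All_less_Suc2 in_set_conv_nth)

lemma set_cyc_word:
  assumes "cyc_word ws"
  shows "set ws \<subset> {0..<n}"
proof (cases ws)
  case Nil
  then show ?thesis using n_ge_2 by auto
next
  case (Cons k vs)
  then have "(k + 1) mod n \<notin> set ws" "(k + 1) mod n < n"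
    using assms Suc_mod_neq [of k] n_ge_2 by (auto simp: cyc_word_Cons)
  then show ?thesis using assms by (auto simp: cyc_word_def)
qed

lemma addable_periodize_cyc_word:
  assumes "cyc_word (k # ws)"
  shows "addable (periodize n (set ws)) (periodize n {k})"
proof -
  have k: "k < n" "k \<notin> set ws" "(k + 1) mod n \<notin> set ws" "cyc_word ws"
    using assms by (simp_all add: cyc_word_Cons)
  then have "i \<notin> periodize n (set ws) \<and> i + 1 \<notin> periodize n (set ws) \<and> i + 1 \<notin> periodize n {k}"
    if "i \<in> periodize n {k}" for i
    using that Suc_mod_neq [of k] in_periodize_Suc [of i k] by (auto simp: in_periodize [of i])
  then show ?thesis using gappy_periodize [OF set_cyc_word [OF k(4)]] by (simp add: addable_def)
qed

lemma word_prod_cyc_word: "cyc_word ws \<Longrightarrow> word_prod n ws = block_cycle (periodize n (set ws))"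
proof (induction ws)
  case Nil
  then show ?case by (simp add: word_prod_Nil periodize_def block_cycle_empty)
next
  case (Cons k ws)
  then have "k < n" "word_prod n ws = block_cycle (periodize n (set ws))"
    by (simp_all add: cyc_word_Cons)
  then have "word_prod n (k # ws) = adj_swap (periodize n {k}) \<circ> block_cycle (periodize n (set ws))"
    by (simp only: word_prod_Cons sref_eq_adj_swap)
  also have "\<dots> = block_cycle (periodize n (set ws) \<union> periodize n {k})"
    by (rule block_cycle_Un [OF addable_periodize_cyc_word [OF Cons.prems], symmetric])
  finally show ?case by (simp only: list.set periodize_insert [of n k "set ws"])
qed

lemma ascent_periodize_singleton:
  assumes "k < n" and w: "shift_equivariant n w"
  shows "(\<forall>i\<in>periodize n {k}. w i < w (i + 1)) \<longleftrightarrow> w (int k) < w (int k + 1)"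
proof
  assume up: "w (int k) < w (int k + 1)"
  show "\<forall>i\<in>periodize n {k}. w i < w (i + 1)"
  proof
    fix i assume "i \<in> periodize n {k}"
    then have i: "i = int k + int n * (i div int n)"
      by (simp add: in_periodize) (metis mod_mult_div_eq)
    have "w i = w (int k) + int n * (i div int n)" "w (i + 1) = w (int k + 1) + int n * (i div int n)"
      using shift_equivariant_mult [OF w, of "int k" "i div int n"]
        shift_equivariant_mult [OF w, of "int k + 1" "i div int n"] i
      by (simp, metis add.assoc add.commute)
    then show "w i < w (i + 1)" using up by simp
  qed
qed (use assms(1) in \<open>auto simp: in_periodize\<close>)

lemma alen_comp_cyc_word:
  assumes "cyc_word ws" "affine_perm n w"
  shows "alen n (w \<circ> word_prod n ws) = alen n w + length ws \<longleftrightarrow> ascending w (periodize n (set ws))"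
  using assms
proof (induction ws arbitrary: w)
  case Nil
  then show ?case by (simp add: word_prod_Nil periodize_def ascending_def)
next
  case (Cons k ws)
  let ?A = "periodize n (set ws)" and ?K = "periodize n {k}"
  have k: "k < n" "cyc_word ws" using Cons.prems by (simp_all add: cyc_word_Cons)
  have w_sref: "affine_perm n (w \<circ> sref n k)" by (rule affine_perm_sref [OF k(1) Cons.prems(2)])
  have alen_le: "alen n ((w \<circ> sref n k) \<circ> word_prod n ws) \<le> alen n (w \<circ> sref n k) + length ws"
    using k(2) by (intro alen_comp_word_prod_le [OF w_sref]) (simp add: cyc_word_def)
  have "ascending w (?A \<union> ?K) \<longleftrightarrow> (\<forall>i\<in>?K. w i < w (i + 1)) \<and> ascending (w \<circ> adj_swap ?K) ?A"
    by (rule ascending_Un [OF addable_periodize_cyc_word [OF Cons.prems(1)]])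
  also have "\<dots> \<longleftrightarrow> w (int k) < w (int k + 1) \<and>
      alen n ((w \<circ> sref n k) \<circ> word_prod n ws) = alen n (w \<circ> sref n k) + length ws"
    unfolding sref_eq_adj_swap [OF k(1), symmetric] Cons.IH [OF k(2) w_sref]
      ascent_periodize_singleton [OF k(1) affine_perm_equivariant [OF Cons.prems(2)]] ..
  also have "\<dots> \<longleftrightarrow> alen n (w \<circ> word_prod n (k # ws)) = alen n w + length (k # ws)"
    unfolding comp_word_prod_Cons using alen_le alen_sref [OF k(1) Cons.prems(2)] by auto
  finally show ?case by (simp only: list.set periodize_insert [of n k "set ws"])
qed

lemma ex_mod_successor_notin:
  assumes "A \<subset> {0..<n}" "A \<noteq> {}"
  shows "\<exists>k\<in>A. (k + 1) mod n \<notin> A"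
proof (rule ccontr)
  assume closed: "\<not> ?thesis"
  obtain a where a: "a \<in> A" "a < n" using assms by fastforce
  have closed_add: "(a + d) mod n \<in> A" for d
  proof (induction d)
    case (Suc d)
    then have "((a + d) mod n + 1) mod n \<in> A" using closed by blast
    then show ?case by (simp add: mod_simps)
  qed (use a in simp)
  have "r \<in> A" if "r < n" for r
    using closed_add [of "r + n - a"] a(2) that by simp
  then show False using assms(1) by auto
qed

lemma ex_cyc_word:
  assumes "A \<subset> {0..<n}"
  shows "\<exists>ws. cyc_word ws \<and> set ws = A"
proof -
  have "finite A" using assms finite_subset by blast
  then show ?thesis using assms
  proof (induction A rule: finite_psubset_induct)
    case (psubset A)
    show ?case
    proof (cases "A = {}")
      case True
      then show ?thesis using cyc_word_Nil by auto
    next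
      case False
      then obtain k where k: "k \<in> A" "(k + 1) mod n \<notin> A"
        using ex_mod_successor_notin [OF psubset.prems] by blast
      moreover obtain ws where "cyc_word ws" "set ws = A - {k}"
        using psubset.IH [of "A - {k}"] psubset.prems k(1) by blast
      ultimately have "cyc_word (k # ws)" "set (k # ws) = A"
        using psubset.prems by (auto simp: cyc_word_Cons)
      then show ?thesis by blast
    qed
  qed
qed

lemma ex_cyc_word_block_cycle:
  assumes "A \<subset> {0..<n}"
  obtains ws where "cyc_word ws" "set ws = A" "length ws = card A"
    "word_prod n ws = block_cycle (periodize n A)"
proof -
  obtain ws where "cyc_word ws" "set ws = A" using ex_cyc_word [OF assms] by blast
  moreover from this have "length ws = card A" by (auto simp: cyc_word_def distinct_card)
  ultimately show thesis using that word_prod_cyc_word by blast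
qed

lemma affine_perm_block_cycle: "A \<subset> {0..<n} \<Longrightarrow> affine_perm n (block_cycle (periodize n A))"
  by (rule ex_cyc_word_block_cycle [of A]) (auto simp: cyc_word_def dest: affine_perm_word_prod)

lemma alen_comp_block_cycle:
  assumes "A \<subset> {0..<n}" "affine_perm n w"
  shows "alen n (w \<circ> block_cycle (periodize n A)) = alen n w + card A \<longleftrightarrow> ascending w (periodize n A)"
  by (rule ex_cyc_word_block_cycle [OF assms(1)]) (use alen_comp_cyc_word [OF _ assms(2)] in metis)

lemma alen_block_cycle:
  assumes "A \<subset> {0..<n}"
  shows "alen n (block_cycle (periodize n A)) = card A"
proof -
  have "k < block_end (periodize n A) k" if "k \<in> periodize n A" for k
    using that block_end_ge [of k "periodize n A"] block_end_notin [OF gappy_periodize [OF assms], of k]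
    by (cases "block_end (periodize n A) k = k") auto
  then have "ascending id (periodize n A)" by (simp add: ascending_def)
  then show ?thesis using alen_comp_block_cycle [OF assms affine_perm_id] by (simp add: alen_id)
qed

lemma cyc_dec_iff_block_cycle: "cyc_dec n v \<longleftrightarrow> v \<in> (\<lambda>A. block_cycle (periodize n A)) ` {A. A \<subset> {0..<n}}"
proof
  assume "cyc_dec n v"
  then show "v \<in> (\<lambda>A. block_cycle (periodize n A)) ` {A. A \<subset> {0..<n}}"
    using word_prod_cyc_word set_cyc_word by (auto simp: cyc_dec_iff_cyc_word)
next
  assume "v \<in> (\<lambda>A. block_cycle (periodize n A)) ` {A. A \<subset> {0..<n}}"
  then obtain A where "A \<subset> {0..<n}" "v = block_cycle (periodize n A)" by blast
  then show "cyc_dec n v"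
    unfolding cyc_dec_iff_cyc_word by (metis alen_block_cycle ex_cyc_word_block_cycle)
qed

lemma bij_betw_block_cycle:
  "bij_betw (\<lambda>A. block_cycle (periodize n A)) {A. A \<subset> {0..<n}} {v. cyc_dec n v}"
  unfolding bij_betw_def
proof
  show "inj_on (\<lambda>A. block_cycle (periodize n A)) {A. A \<subset> {0..<n}}"
    by (rule inj_on_subset [OF inj_on_block_cycle_periodize]) auto
qed (simp add: set_eq_iff cyc_dec_iff_block_cycle)

lemma affine_perm_cyc_dec: "cyc_dec n v \<Longrightarrow> affine_perm n v"
  using affine_perm_block_cycle by (auto simp: cyc_dec_iff_block_cycle)

lemma finite_cyc_dec: "finite {v. cyc_dec n v}"
proof (rule bij_betw_finite [OF bij_betw_block_cycle, THEN iffD1])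
  show "finite {A. A \<subset> {0..<n}}" by (rule finite_subset [of _ "Pow {0..<n}"]) auto
qed

lemma cyc_dec_id: "cyc_dec n id"
  using cyc_word_Nil alen_id
  by (auto simp: cyc_dec_iff_cyc_word word_prod_Nil intro!: exI [of _ "[]"])

end

section \<open>Traces over carriers\<close>

text \<open>The carrier enters at position a + n with the value e and has to leave at position a with the
  value e - n, as it would if the sequence were shift-equivariant.\<close>

definition carrier_trace ::
    "int set \<Rightarrow> nat \<Rightarrow> int \<Rightarrow> 'a::comm_ring_1 \<Rightarrow> ((int \<Rightarrow> int) \<Rightarrow> 'a) \<Rightarrow> (int \<Rightarrow> int) \<Rightarrow> 'a" where
  "carrier_trace F n a x \<phi> g =
    (\<Sum>e\<in>F. nilcox_row a n x (\<lambda>h. if h a = e - int n then \<phi> h else 0) (g(a + int n := e)))"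

lemma block_end_truncate:
  assumes "gappy P" "a \<le> k" "k \<le> b" and g: "\<forall>i\<in>{a..<b}. g i = w i"
  shows "(g(b := w (block_end P b))) (block_end (P \<inter> {a..<b}) k) = w (block_end P k)"
proof (cases "block_end P k < b")
  case True
  then show ?thesis using block_end_ge [of k P] assms(2)
    by (simp add: block_end_Int_atLeastLessThan [OF assms(1-3)] g)
next
  case False
  then have "block_end P b = block_end P k" by (intro block_end_eq_if_between assms) simp
  then show ?thesis using False by (simp add: block_end_Int_atLeastLessThan [OF assms(1-3)])
qed

lemma block_cycle_truncate:
  assumes "gappy P" "a < b" and g: "\<forall>i\<in>{a..<b}. g i = w i"
  shows "(g(b := w (block_end P b)) \<circ> block_cycle (P \<inter> {a..<b}))(a := p) =
    (override_on g (w \<circ> block_cycle P) {a<..b})(a := p)"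
proof
  fix k
  let ?C = "P \<inter> {a..<b}"
  consider (inside) "a < k" "k \<le> b" | (at) "k = a" | (outside) "k < a \<or> b < k" by linarith
  then show "((g(b := w (block_end P b)) \<circ> block_cycle ?C)(a := p)) k =
      ((override_on g (w \<circ> block_cycle P) {a<..b})(a := p)) k"
  proof cases
    case inside
    then show ?thesis using block_end_truncate [OF assms(1) _ _ g, of k] g
      by (auto simp: block_cycle_def)
  next
    case outside
    then have "k \<notin> ?C" "k - 1 \<notin> ?C" by auto
    then show ?thesis using outside assms(2) by (auto simp: block_cycle_def block_end_outside)
  qed simp
qed

lemma block_cycle_truncate_first:
  assumes "gappy P" "block_end P a < b" and g: "\<forall>i\<in>{a..<b}. g i = w i"
  shows "(g(b := e) \<circ> block_cycle (P \<inter> {a..<b})) a = w (block_end P a)"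
  using block_end_ge [of a P] block_end_Int_atLeastLessThan [OF assms(1), of a a b] assms(2)
  by (simp add: block_cycle_def g)

lemma ascending_truncate:
  assumes "n > 0" and gap: "gappy (periodize n A)" and w: "shift_equivariant n w"
    and g: "\<forall>i\<in>{a..<a + int n}. g i = w i"
  shows "ascending (g(a + int n := w (block_end (periodize n A) (a + int n))))
      (periodize n A \<inter> {a..<a + int n}) \<longleftrightarrow>
    ascending w (periodize n A)"
proof -
  let ?P = "periodize n A" and ?b = "a + int n"
  let ?G = "g(?b := w (block_end ?P ?b))"
  have "?G k = w k \<and> ?G (block_end (?P \<inter> {a..<?b}) k) = w (block_end ?P k)"
    if "k \<in> ?P \<inter> {a..<?b}" for k
    using that g block_end_truncate [OF gap _ _ g, of k] by simp
  then show ?thesis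
    unfolding ascending_periodize_window [OF assms(1-3), of a] by (simp add: ascending_def)
qed

lemma periodize_residues:
  assumes "C \<subseteq> {a..<a + int n}"
  shows "periodize n ((\<lambda>k. nat (k mod int n)) ` C) \<inter> {a..<a + int n} = C"
proof (cases "n = 0")
  case False
  then have "inj_on (\<lambda>k. nat (k mod int n)) {a..<a + int n}"
    using bij_betw_residues [of n a] by (simp add: bij_betw_def)
  then show ?thesis using assms by (auto simp: periodize_def dest: inj_onD)
qed (use assms in auto)

lemma nilcox_row_expand_residues:
  assumes "n > 0"
  shows "nilcox_row a n x \<phi> w = (\<Sum>A\<in>Pow {0..<n}.
    if ascending w (periodize n A \<inter> {a..<a + int n})
    then x ^ card A * \<phi> (w \<circ> block_cycle (periodize n A \<inter> {a..<a + int n})) else 0)"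
proof -
  let ?W = "{a..<a + int n}" and ?res = "(`) (\<lambda>k. nat (k mod int n))"
  let ?f = "\<lambda>A. if ascending w (periodize n A \<inter> ?W)
    then x ^ card A * \<phi> (w \<circ> block_cycle (periodize n A \<inter> ?W)) else 0"
  note bij = bij_betw_residues [OF assms, of a]
  have card: "card (?res C) = card C" if "C \<subseteq> ?W" for C
    using that bij by (intro card_image) (auto simp: bij_betw_def intro: inj_on_subset)
  have "nilcox_row a n x \<phi> w = (\<Sum>C\<in>Pow ?W. ?f (?res C))"
    unfolding nilcox_row_expand by (intro sum.cong refl) (simp add: periodize_residues card)
  also have "\<dots> = (\<Sum>A\<in>Pow {0..<n}. ?f A)"
    by (rule sum.reindex_bij_betw [OF bij_betw_Pow [OF bij]])
  finally show ?thesis .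
qed

definition carrier_term ::
    "nat \<Rightarrow> int \<Rightarrow> ((int \<Rightarrow> int) \<Rightarrow> 'a::comm_ring_1) \<Rightarrow> (int \<Rightarrow> int) \<Rightarrow> nat set \<Rightarrow> int \<Rightarrow> 'a" where
  "carrier_term n a \<phi> g A e =
    (let G = g(a + int n := e); C = periodize n A \<inter> {a..<a + int n}
     in if ascending G C \<and> (G \<circ> block_cycle C) a = e - int n then \<phi> (G \<circ> block_cycle C) else 0)"

lemma carrier_trace_eq_sum_carrier_term:
  assumes "n > 0"
  shows "carrier_trace F n a x \<phi> g =
    (\<Sum>A\<in>Pow {0..<n}. x ^ card A * (\<Sum>e\<in>F. carrier_term n a \<phi> g A e))"
proof -
  have "carrier_trace F n a x \<phi> g = (\<Sum>e\<in>F. \<Sum>A\<in>Pow {0..<n}. x ^ card A * carrier_term n a \<phi> g A e)"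
    unfolding carrier_trace_def nilcox_row_expand_residues [OF assms]
    by (intro sum.cong refl) (simp add: carrier_term_def Let_def)
  also have "\<dots> = (\<Sum>A\<in>Pow {0..<n}. x ^ card A * (\<Sum>e\<in>F. carrier_term n a \<phi> g A e))"
    unfolding sum_distrib_left by (rule sum.swap)
  finally show ?thesis .
qed

lemma carrier_term_full:
  assumes "n > 0"
  shows "carrier_term n a \<phi> g {0..<n} e = 0"
proof -
  have "periodize n {0..<n} \<inter> {a..<a + int n} = {a..<a + int n}"
    using assms by (auto simp: periodize_def nat_less_iff)
  then show ?thesis using assms by (simp add: carrier_term_def block_cycle_atLeastLessThan)
qed

text \<open>A proper set A of exchange sites determines the value of the carrier.\<close>

lemma sum_carrier_term_proper:
  assumes n: "n > 0" and w: "shift_equivariant n w"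
    and F: "finite F" "w ` {a + int n..<a + 2 * int n} \<subseteq> F"
    and g: "\<forall>i\<in>{a..<a + int n}. g i = w i" and \<phi>: "\<And>h p. \<phi> (h(a := p)) = \<phi> h"
    and A: "A \<subset> {0..<n}"
  shows "(\<Sum>e\<in>F. carrier_term n a \<phi> g A e) =
    (if ascending w (periodize n A)
     then \<phi> (override_on g (w \<circ> block_cycle (periodize n A)) {a<..a + int n}) else 0)"
proof -
  let ?N = "int n" and ?P = "periodize n A"
  let ?C = "?P \<inter> {a..<a + ?N}" and ?G = "\<lambda>e. g(a + ?N := e)"
  note gap = gappy_periodize [OF A]
  define e\<^sub>0 where "e\<^sub>0 = w (block_end ?P (a + ?N))"
  have e\<^sub>0: "e\<^sub>0 = w (block_end ?P a) + ?N"
    using block_end_periodize_add_mult [OF gap, of a 1] shift_equivariantD [OF w]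
    by (simp add: e\<^sub>0_def)
  have "e\<^sub>0 \<in> F"
    using F(2) block_end_ge [of "a + ?N" ?P] block_end_periodize_less [OF n gap, of "a + ?N"]
    by (auto simp: e\<^sub>0_def)
  have exit: "(?G e \<circ> block_cycle ?C) a = e - ?N \<longleftrightarrow> e = e\<^sub>0" for e
    using block_cycle_truncate_first [OF gap block_end_periodize_less [OF n gap] g, where e = e] e\<^sub>0
    by auto
  have asc: "ascending (?G e\<^sub>0) ?C \<longleftrightarrow> ascending w ?P"
    unfolding e\<^sub>0_def by (rule ascending_truncate [OF n gap w g])
  have "\<phi> (?G e\<^sub>0 \<circ> block_cycle ?C) = \<phi> (override_on g (w \<circ> block_cycle ?P) {a<..a + ?N})"
    using block_cycle_truncate [OF gap _ g] n \<phi> unfolding e\<^sub>0_def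
    by (metis less_add_same_cancel1 of_nat_0_less_iff)
  then have "carrier_term n a \<phi> g A e =
      (if e = e\<^sub>0 then if ascending w ?P
       then \<phi> (override_on g (w \<circ> block_cycle ?P) {a<..a + ?N}) else 0 else 0)" for e
    unfolding carrier_term_def Let_def exit
    by (cases "e = e\<^sub>0") (simp_all only: asc simp_thms if_True if_False)
  then show ?thesis using F(1) \<open>e\<^sub>0 \<in> F\<close> by (simp only: sum.delta if_True)
qed

lemma carrier_trace_expand:
  fixes x :: "'a::comm_ring_1"
  assumes n: "n > 0" and w: "shift_equivariant n w"
    and F: "finite F" "w ` {a + int n..<a + 2 * int n} \<subseteq> F"
    and g: "\<forall>i\<in>{a..<a + int n}. g i = w i"
    and \<phi>: "\<And>h p. \<phi> (h(a := p)) = \<phi> h"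
  shows "carrier_trace F n a x \<phi> g = (\<Sum>A | A \<subset> {0..<n}. if ascending w (periodize n A)
    then x ^ card A * \<phi> (override_on g (w \<circ> block_cycle (periodize n A)) {a<..a + int n}) else 0)"
proof -
  have "carrier_trace F n a x \<phi> g =
      (\<Sum>A | A \<subset> {0..<n}. x ^ card A * (\<Sum>e\<in>F. carrier_term n a \<phi> g A e))"
    unfolding carrier_trace_eq_sum_carrier_term [OF n]
    by (intro sum.mono_neutral_right) (auto simp: carrier_term_full [OF n])
  also have "\<dots> = (\<Sum>A | A \<subset> {0..<n}. if ascending w (periodize n A)
      then x ^ card A * \<phi> (override_on g (w \<circ> block_cycle (periodize n A)) {a<..a + int n}) else 0)"
    by (intro sum.cong refl) (simp add: sum_carrier_term_proper [OF n w F g \<phi>])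
  finally show ?thesis .
qed

text \<open>The hypothesis says that T and T' are conjugate by 1 + c u, with u the nilCoxeter generator on
  pairs; for each unordered pair {e, f} this is an identity of traces of 2 by 2 matrices.\<close>

lemma twisted_pair_trace_eq:
  fixes T T' :: "int \<Rightarrow> int \<Rightarrow> int \<Rightarrow> int \<Rightarrow> 'a::{idom,ring_char_0}"
  assumes conj: "\<And>e f p q. T e f p q + (if e < f then c * T f e p q else 0) =
      T' e f p q + (if q < p then c * T' e f q p else 0)"
  shows "(\<Sum>e\<in>F. \<Sum>f\<in>F. T e f (e - s) (f - s)) = (\<Sum>e\<in>F. \<Sum>f\<in>F. T' e f (e - s) (f - s))"
proof -
  define d where "d e f = T e f (e - s) (f - s) - T' e f (e - s) (f - s)" for e f
  have off_diagonal: "d e f = - d f e" if "e < f" for e f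
    using conj [of e f "e - s" "f - s"] conj [of f e "f - s" "e - s"] conj [of f e "e - s" "f - s"] that
    by (simp add: d_def algebra_simps)
  have diagonal: "d e e = 0" for e using conj [of e e "e - s" "e - s"] by (simp add: d_def)
  have antisymmetric: "d e f = - d f e" for e f
    using off_diagonal [of e f] off_diagonal [of f e] diagonal [of e]
    by (cases e f rule: linorder_cases) auto
  have "(\<Sum>e\<in>F. \<Sum>f\<in>F. d e f) = (\<Sum>e\<in>F. \<Sum>f\<in>F. - d f e)" by (simp add: antisymmetric [symmetric])
  also have "\<dots> = - (\<Sum>e\<in>F. \<Sum>f\<in>F. d f e)" by (simp add: sum_negf)
  also have "(\<Sum>e\<in>F. \<Sum>f\<in>F. d f e) = (\<Sum>e\<in>F. \<Sum>f\<in>F. d e f)" by (rule sum.swap)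
  finally have "2 * (\<Sum>e\<in>F. \<Sum>f\<in>F. d e f) = 0" by simp
  then have "(\<Sum>e\<in>F. \<Sum>f\<in>F. d e f) = 0" by simp
  then show ?thesis by (simp add: d_def sum_subtractf)
qed

definition carrier_pair_transfer ::
    "nat \<Rightarrow> (int \<Rightarrow> int) \<Rightarrow> 'a::comm_ring_1 \<Rightarrow> 'a \<Rightarrow> int \<Rightarrow> int \<Rightarrow> int \<Rightarrow> int \<Rightarrow> 'a" where
  "carrier_pair_transfer n z x y e f p q =
    nilcox_row 0 n x (nilcox_row 1 n y (delta_on {0..int n + 1} (z(0 := p, 1 := q))))
      (id(int n := e, int n + 1 := f))"

lemma carrier_pair_transfer_exchange:
  fixes x y :: "'a::comm_ring_1"
  shows "carrier_pair_transfer n z x y e f p q +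
      (if e < f then (x - y) * carrier_pair_transfer n z x y f e p q else 0) =
    carrier_pair_transfer n z y x e f p q +
      (if q < p then (x - y) * carrier_pair_transfer n z y x e f q p else 0)"
    (is "?lhs = ?rhs")
proof -
  let ?N = "int n"
  let ?in = "\<lambda>e f. id(?N := e, ?N + 1 := f)"
    and ?out = "\<lambda>p q. delta_on {0..?N + 1} (z(0 := p, 1 := q)) :: _ \<Rightarrow> 'a"
  have in_swap: "?in e f \<circ> transpose ?N (?N + 1) = ?in f e"
    by (auto simp: fun_eq_iff transpose_def)
  have out_swap: "z(0 := p, 1 := q) \<circ> transpose 0 1 = z(0 := q, 1 := p)"
    by (auto simp: fun_eq_iff transpose_def)
  have "nilcox 0 (?out p q) = (if q < p then ?out q p else (\<lambda>w. 0))"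
    by (subst nilcox_delta_on) (simp_all add: out_swap del: o_apply)
  then have out_exp: "nilcox_exp 0 (x - y) (?out p q) =
      (\<lambda>w. ?out p q w + (if q < p then x - y else 0) * ?out q p w)"
    by (auto simp: nilcox_exp_def fun_eq_iff)
  have "?lhs = nilcox_exp ?N (x - y) (nilcox_row 0 n x (nilcox_row 1 n y (?out p q))) (?in e f)"
    unfolding nilcox_exp_def nilcox_def in_swap carrier_pair_transfer_def by simp
  also have "\<dots> = nilcox_row 0 n y (nilcox_row 1 n x (nilcox_exp 0 (x - y) (?out p q))) (?in e f)"
    using nilcox_row_exchange [of 0 n x y "?out p q"] by simp
  also have "\<dots> = ?rhs"
    unfolding out_exp nilcox_row_lincomb by (simp add: carrier_pair_transfer_def)
  finally show ?thesis .
qed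

lemma sum_carrier_pair_transfer_eq_carrier_trace:
  fixes x y :: "'a::comm_ring_1"
  shows "(\<Sum>e\<in>F. carrier_pair_transfer n z x y e f (e - int n) (f - int n)) =
   carrier_trace F n 0 x
     (nilcox_row 1 n y (\<lambda>g. if g 1 = f - int n then delta_on {2..int n + 1} z g else 0))
     (id(int n + 1 := f))"
proof -
  let ?N = "int n"
  have sites: "{0..?N + 1} = insert 0 (insert 1 {2..?N + 1})" by auto
  have tail: "delta_on {2..?N + 1} (z(0 := p, 1 := q)) = delta_on {2..?N + 1} z" for p q
    by (rule delta_on_cong) auto
  have "delta_on {0..?N + 1} (z(0 := p, 1 := q)) =
      (\<lambda>g. if g 0 = p then if g 1 = q then delta_on {2..?N + 1} z g else 0 else 0 :: 'a)" for p q
    unfolding sites delta_on_insert tail by (auto simp: fun_eq_iff)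
  moreover have "id(?N := e, ?N + 1 := f) = id(?N + 1 := f, 0 + ?N := e)" for e
    by (auto simp: fun_eq_iff)
  ultimately show ?thesis
    unfolding carrier_trace_def carrier_pair_transfer_def
    by (simp only: nilcox_row_guard zero_less_one)
qed

context affine_symmetric_group
begin

lemma cyc_dec_bounds:
  assumes "cyc_dec n v"
  shows "v k \<in> {k - 1..k + int n}"
proof -
  obtain A where "A \<subset> {0..<n}" "v = block_cycle (periodize n A)"
    using assms by (auto simp: cyc_dec_iff_block_cycle)
  then show ?thesis
    using block_end_periodize_less [OF _ gappy_periodize, of n A k] block_end_ge [of k "periodize n A"]
      n_ge_2
    by (auto simp: block_cycle_def)
qed

lemma carrier_trace_cyc_dec:
  fixes x :: "'a::comm_ring_1"
  assumes w: "affine_perm n w" and F: "finite F" "w ` {a + int n..<a + 2 * int n} \<subseteq> F"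
    and g: "\<forall>i\<in>{a..<a + int n}. g i = w i" and \<phi>: "\<And>h p. \<phi> (h(a := p)) = \<phi> h"
  shows "carrier_trace F n a x \<phi> g = (\<Sum>v | cyc_dec n v. if alen n (w \<circ> v) = alen n w + alen n v
    then x ^ alen n v * \<phi> (override_on g (w \<circ> v) {a<..a + int n}) else 0)"
proof -
  let ?f = "\<lambda>v. if alen n (w \<circ> v) = alen n w + alen n v
    then x ^ alen n v * \<phi> (override_on g (w \<circ> v) {a<..a + int n}) else 0"
  have "carrier_trace F n a x \<phi> g = (\<Sum>A | A \<subset> {0..<n}. if ascending w (periodize n A)
      then x ^ card A * \<phi> (override_on g (w \<circ> block_cycle (periodize n A)) {a<..a + int n}) else 0)"
    using n_ge_2 by (intro carrier_trace_expand affine_perm_equivariant w F g \<phi>) simp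
  also have "\<dots> = (\<Sum>A | A \<subset> {0..<n}. ?f (block_cycle (periodize n A)))"
    by (intro sum.cong refl) (simp add: alen_block_cycle alen_comp_block_cycle w)
  also have "\<dots> = (\<Sum>v | cyc_dec n v. ?f v)" by (rule sum.reindex_bij_betw [OF bij_betw_block_cycle])
  finally show ?thesis .
qed

definition cyc_dec_pairs :: "(int \<Rightarrow> int) \<Rightarrow> ((int \<Rightarrow> int) \<times> (int \<Rightarrow> int)) set" where
  "cyc_dec_pairs z = length_additive_factorizations z \<inter> {u. cyc_dec n u} \<times> {v. cyc_dec n v}"

lemma cyc_dec_pairs_iff:
  "(u, v) \<in> cyc_dec_pairs z \<longleftrightarrow> cyc_dec n u \<and> cyc_dec n v \<and> u \<circ> v = z \<and> alen n z = alen n u + alen n v"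
  using affine_perm_cyc_dec by (auto simp: cyc_dec_pairs_def length_additive_factorizations_def)

lemma finite_cyc_dec_pairs: "finite (cyc_dec_pairs z)"
  by (simp add: cyc_dec_pairs_def finite_length_additive_factorizations)

lemma delta_on_window_eq:
  assumes "affine_perm n u" "affine_perm n z"
  shows "delta_on {a..<a + int n} z u = (if u = z then 1 else 0)"
  using shift_equivariant_eqI [of n u z a] assms affine_perm_equivariant n_ge_2
  by (auto simp: delta_on_def)

lemma carrier_trace_delta_on:
  fixes y :: "'a::comm_ring_1"
  assumes z: "affine_perm n z" and u: "cyc_dec n u"
  shows "carrier_trace {0..3 * int n} n 1 y (delta_on {2..int n + 1} z) (override_on id u {0<..int n}) =
    (\<Sum>v | cyc_dec n v. if (u, v) \<in> cyc_dec_pairs z then y ^ alen n v else 0)"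
proof -
  let ?g = "override_on id u {0<..int n}" and ?\<delta> = "delta_on {2..int n + 1} z"
  have \<delta>: "?\<delta> (override_on ?g (u \<circ> v) {1<..1 + int n}) = (if u \<circ> v = z then 1 else 0)"
    if v: "cyc_dec n v" for v
  proof -
    have "{2..int n + 1} = {2..<2 + int n}" by auto
    then have "?\<delta> (u \<circ> v) = (if u \<circ> v = z then 1 else 0)"
      using delta_on_window_eq [OF affine_perm_comp z, of u v 2] affine_perm_cyc_dec u v by simp
    then show ?thesis by (simp add: delta_on_def)
  qed
  have "carrier_trace {0..3 * int n} n 1 y ?\<delta> ?g =
      (\<Sum>v | cyc_dec n v. if alen n (u \<circ> v) = alen n u + alen n v
      then y ^ alen n v * ?\<delta> (override_on ?g (u \<circ> v) {1<..1 + int n}) else 0)"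
  proof (rule carrier_trace_cyc_dec [OF affine_perm_cyc_dec [OF u]])
    show "u ` {1 + int n..<1 + 2 * int n} \<subseteq> {0..3 * int n}"
    proof (rule image_subsetI)
      show "u k \<in> {0..3 * int n}" if "k \<in> {1 + int n..<1 + 2 * int n}" for k
        using cyc_dec_bounds [OF u, of k] that by simp
    qed
  qed (auto simp: delta_on_def)
  also have "\<dots> = (\<Sum>v | cyc_dec n v. if (u, v) \<in> cyc_dec_pairs z then y ^ alen n v else 0)"
    by (intro sum.cong refl) (simp add: \<delta>, use u in \<open>auto simp: cyc_dec_pairs_iff\<close>)
  finally show ?thesis .
qed

lemma carrier_trace_id:
  fixes x :: "'a::comm_ring_1"
  assumes "\<And>h p. \<phi> (h(0 := p)) = \<phi> h"
  shows "carrier_trace {0..3 * int n} n 0 x \<phi> (id(int n + 1 := f)) =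
    (\<Sum>u | cyc_dec n u. x ^ alen n u * \<phi> ((override_on id u {0<..int n})(1 + int n := f)))"
proof -
  have "carrier_trace {0..3 * int n} n 0 x \<phi> (id(int n + 1 := f)) =
      (\<Sum>u | cyc_dec n u. if alen n (id \<circ> u) = alen n id + alen n u
       then x ^ alen n u * \<phi> (override_on (id(int n + 1 := f)) (id \<circ> u) {0<..0 + int n}) else 0)"
    using assms by (intro carrier_trace_cyc_dec affine_perm_id) auto
  moreover have "override_on (id(int n + 1 := f)) u {0<..int n} =
      (override_on id u {0<..int n})(1 + int n := f)"
    for u
    by (auto simp: fun_eq_iff override_on_def)
  ultimately show ?thesis by (simp add: alen_id)
qed

lemma carrier_pair_trace:
  fixes x y :: "'a::comm_ring_1"
  assumes z: "affine_perm n z"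
  shows "(\<Sum>e\<in>{0..3 * int n}. \<Sum>f\<in>{0..3 * int n}.
      carrier_pair_transfer n z x y e f (e - int n) (f - int n)) =
    (\<Sum>(u, v)\<in>cyc_dec_pairs z. x ^ alen n u * y ^ alen n v)"
proof -
  let ?F = "{0..3 * int n}" and ?N = "int n" and ?C = "{v. cyc_dec n v}"
  define \<phi> where "\<phi> f = nilcox_row 1 n y (\<lambda>g. if g 1 = f - ?N then delta_on {2..?N + 1} z g else 0)"
    for f
  have "\<phi> f (h(0 := p)) = \<phi> f h" for f h p
    unfolding \<phi>_def by (rule nilcox_row_update_below) (auto simp: delta_on_def)
  then have first_carrier: "carrier_trace ?F n 0 x (\<phi> f) (id(?N + 1 := f)) =
      (\<Sum>u\<in>?C. x ^ alen n u * \<phi> f ((override_on id u {0<..?N})(1 + ?N := f)))" for f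
    by (rule carrier_trace_id)
  have "(\<Sum>e\<in>?F. \<Sum>f\<in>?F. carrier_pair_transfer n z x y e f (e - ?N) (f - ?N)) =
      (\<Sum>f\<in>?F. carrier_trace ?F n 0 x (\<phi> f) (id(?N + 1 := f)))"
    unfolding \<phi>_def sum_carrier_pair_transfer_eq_carrier_trace [symmetric] by (rule sum.swap)
  also have "\<dots> = (\<Sum>u\<in>?C. \<Sum>f\<in>?F. x ^ alen n u * \<phi> f ((override_on id u {0<..?N})(1 + ?N := f)))"
    unfolding first_carrier by (rule sum.swap)
  also have "\<dots> = (\<Sum>u\<in>?C. x ^ alen n u *
      carrier_trace ?F n 1 y (delta_on {2..?N + 1} z) (override_on id u {0<..?N}))"
    by (simp add: \<phi>_def carrier_trace_def sum_distrib_left)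
  also have "\<dots> = (\<Sum>u\<in>?C. \<Sum>v\<in>?C. if (u, v) \<in> cyc_dec_pairs z then x ^ alen n u * y ^ alen n v else 0)"
    by (intro sum.cong refl)
      (simp add: carrier_trace_delta_on [OF z] sum_distrib_left if_distrib cong: if_cong)
  also have "\<dots> = (\<Sum>(u, v)\<in>?C \<times> ?C. if (u, v) \<in> cyc_dec_pairs z then x ^ alen n u * y ^ alen n v else 0)"
    by (rule sum.cartesian_product)
  also have "\<dots> = (\<Sum>(u, v)\<in>cyc_dec_pairs z. x ^ alen n u * y ^ alen n v)"
  proof (rule sum.mono_neutral_cong_right)
    show "cyc_dec_pairs z \<subseteq> ?C \<times> ?C" by (auto simp: cyc_dec_pairs_def)
  qed (auto simp: finite_cyc_dec)
  finally show ?thesis .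
qed

lemma cyc_dec_pairs_symmetric:
  fixes x y :: "'a::{idom,ring_char_0}"
  assumes "affine_perm n z"
  shows "(\<Sum>(u, v)\<in>cyc_dec_pairs z. x ^ alen n u * y ^ alen n v) =
    (\<Sum>(u, v)\<in>cyc_dec_pairs z. y ^ alen n u * x ^ alen n v)"
  unfolding carrier_pair_trace [OF assms, symmetric]
  by (rule twisted_pair_trace_eq [OF carrier_pair_transfer_exchange])

text \<open>Since the sum of the two lengths is constant, it suffices to compare coefficients at y = 1.\<close>

lemma card_cyc_dec_pairs_swap:
  assumes z: "affine_perm n z"
  shows "card {(u, v) \<in> cyc_dec_pairs z. alen n u = a \<and> alen n v = b} =
    card {(u, v) \<in> cyc_dec_pairs z. alen n u = b \<and> alen n v = a}"
proof (cases "alen n z = a + b")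
  case True
  let ?E = "cyc_dec_pairs z"
  have coeff: "coeff (\<Sum>p\<in>?E. monom (1::int) (f p)) a = int (card {p \<in> ?E. f p = a})" for f
    by (simp add: coeff_sum sum.If_cases [OF finite_cyc_dec_pairs] Int_def)
  have "(\<Sum>p\<in>?E. monom (1::int) (alen n (fst p))) = (\<Sum>p\<in>?E. monom (1::int) (alen n (snd p)))"
    using cyc_dec_pairs_symmetric [OF z, of "monom (1::int) 1" 1]
    by (simp add: monom_power case_prod_unfold)
  then have "card {p \<in> ?E. alen n (fst p) = a} = card {p \<in> ?E. alen n (snd p) = a}"
    using coeff [of "\<lambda>p. alen n (fst p)"] coeff [of "\<lambda>p. alen n (snd p)"] by simp
  moreover have "{p \<in> ?E. alen n (fst p) = a} = {(u, v) \<in> ?E. alen n u = a \<and> alen n v = b}"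
    "{p \<in> ?E. alen n (snd p) = a} = {(u, v) \<in> ?E. alen n u = b \<and> alen n v = a}"
    using True by (auto simp: cyc_dec_pairs_iff)
  ultimately show ?thesis by simp
next
  case False
  then have "{(u, v) \<in> cyc_dec_pairs z. alen n u = a \<and> alen n v = b} = {}"
    "{(u, v) \<in> cyc_dec_pairs z. alen n u = b \<and> alen n v = a} = {}"
    by (auto simp: cyc_dec_pairs_iff)
  then show ?thesis by (simp only:)
qed

end

section \<open>Symmetry and positivity\<close>

definition comp_list :: "('a \<Rightarrow> 'a) list \<Rightarrow> 'a \<Rightarrow> 'a" where
  "comp_list fs = foldr (\<circ>) fs id"

lemma comp_list_Nil: "comp_list [] = id"
  by (simp add: comp_list_def)

lemma comp_list_Cons: "comp_list (f # fs) = f \<circ> comp_list fs"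
  by (simp add: comp_list_def)

lemma comp_list_append: "comp_list (fs @ gs) = comp_list fs \<circ> comp_list gs"
  by (induction fs) (simp_all add: comp_list_Nil comp_list_Cons comp_assoc)

lemma partition_eqI:
  assumes "is_partition lam" "is_partition mu" "mset lam = mset mu"
  shows "lam = mu"
proof -
  have "sorted (rev lam)" "sorted (rev mu)"
    using assms(1,2) by (simp_all add: is_partition_def sorted_wrt_rev)
  then have "rev lam = rev mu" using assms(3) by (metis mset_rev properties_for_sort)
  then show ?thesis by simp
qed

lemma finite_partitions: "finite {lam. is_partition lam \<and> sum_list lam = m}"
proof (rule finite_subset)
  show "finite {xs. set xs \<subseteq> {..m} \<and> length xs \<le> m}" by (rule finite_lists_length_le) simp
  have "length xs \<le> sum_list xs" if "\<forall>x\<in>set xs. 0 < x" for xs :: "nat list"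
    using that by (induction xs) auto
  then show "{lam. is_partition lam \<and> sum_list lam = m} \<subseteq> {xs. set xs \<subseteq> {..m} \<and> length xs \<le> m}"
    by (auto simp: is_partition_def member_le_sum_list)
qed

definition exponent_partition :: "(nat \<Rightarrow>\<^sub>0 nat) \<Rightarrow> nat list" where
  "exponent_partition \<alpha> =
    rev (sorted_list_of_multiset (image_mset (Poly_Mapping.lookup \<alpha>) (mset_set (Poly_Mapping.keys \<alpha>))))"

lemma mset_exponent_partition:
  "mset (exponent_partition \<alpha>) = image_mset (Poly_Mapping.lookup \<alpha>) (mset_set (Poly_Mapping.keys \<alpha>))"
  by (simp add: exponent_partition_def)

lemma is_partition_exponent_partition: "is_partition (exponent_partition \<alpha>)"
proof -
  have "set (exponent_partition \<alpha>) = Poly_Mapping.lookup \<alpha> ` Poly_Mapping.keys \<alpha>"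
    using arg_cong [OF mset_exponent_partition, of set_mset \<alpha>] by simp
  then have "\<forall>x\<in>set (exponent_partition \<alpha>). 0 < x" by (auto simp: in_keys_iff)
  then show ?thesis by (simp add: is_partition_def exponent_partition_def sorted_wrt_rev)
qed

lemma mono_sym_eq: "mono_sym lam \<alpha> = (if lam = exponent_partition \<alpha> then 1 else 0)"
  unfolding mono_sym_def mset_exponent_partition [symmetric]
  using partition_eqI is_partition_exponent_partition by auto

context affine_symmetric_group
begin

abbreviation cyc_dec_with_lengths :: "(int \<Rightarrow> int) list \<Rightarrow> nat list \<Rightarrow> bool" where
  "cyc_dec_with_lengths vs as \<equiv> list_all2 (\<lambda>v a. cyc_dec n v \<and> alen n v = a) vs as"

definition cyc_factorizations :: "(int \<Rightarrow> int) \<Rightarrow> nat list \<Rightarrow> (int \<Rightarrow> int) list set" where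
  "cyc_factorizations u as = {vs. cyc_dec_with_lengths vs as \<and>
    comp_list vs = u \<and> alen n u = sum_list as}"

lemma comp_list_cyc_dec:
  assumes "cyc_dec_with_lengths vs as"
  shows "affine_perm n (comp_list vs)" "alen n (comp_list vs) \<le> sum_list as"
proof -
  have "affine_perm n (comp_list vs) \<and> alen n (comp_list vs) \<le> sum_list as"
    using assms
  proof (induction vs as)
    case (Cons v vs a as)
    then have v: "affine_perm n v" "alen n v = a" and vs: "affine_perm n (comp_list vs)"
      using affine_perm_cyc_dec by auto
    then show ?case unfolding comp_list_Cons
      using Cons.IH affine_perm_comp [OF v(1) vs] alen_comp_le [OF v(1) vs] by (simp del: o_apply)
  qed (simp add: comp_list_Nil affine_perm_id alen_id del: id_apply)
  then show "affine_perm n (comp_list vs)" "alen n (comp_list vs) \<le> sum_list as" by auto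
qed

lemma finite_cyc_factorizations: "finite (cyc_factorizations u as)"
proof (rule finite_subset)
  show "finite {vs. set vs \<subseteq> {v. cyc_dec n v} \<and> length vs = length as}"
    by (rule finite_lists_length_eq [OF finite_cyc_dec])
  show "cyc_factorizations u as \<subseteq> {vs. set vs \<subseteq> {v. cyc_dec n v} \<and> length vs = length as}"
    by (auto simp: cyc_factorizations_def list_all2_conv_all_nth in_set_conv_nth)
qed

lemma length_cyc_factorizations: "vs \<in> cyc_factorizations u as \<Longrightarrow> length vs = length as"
  by (auto simp: cyc_factorizations_def dest: list_all2_lengthD)

lemma append_mem_cyc_factorizations_iff:
  assumes "length vs = length as"
  shows "vs @ ws \<in> cyc_factorizations u (as @ bs) \<longleftrightarrow>
    (comp_list vs, comp_list ws) \<in> length_additive_factorizations u \<and>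
    vs \<in> cyc_factorizations (comp_list vs) as \<and> ws \<in> cyc_factorizations (comp_list ws) bs"
proof -
  have "alen n u = sum_list as + sum_list bs \<longleftrightarrow> alen n u = alen n (comp_list vs) + alen n (comp_list ws) \<and>
      alen n (comp_list vs) = sum_list as \<and> alen n (comp_list ws) = sum_list bs"
    if "cyc_dec_with_lengths vs as" "cyc_dec_with_lengths ws bs"
      "u = comp_list vs \<circ> comp_list ws"
    using alen_comp_le [OF comp_list_cyc_dec(1) [OF that(1)] comp_list_cyc_dec(1) [OF that(2)]]
      comp_list_cyc_dec(2) [OF that(1)] comp_list_cyc_dec(2) [OF that(2)] unfolding that(3) by linarith
  then show ?thesis using assms comp_list_cyc_dec(1)
    by (auto simp: cyc_factorizations_def length_additive_factorizations_def comp_list_append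
        list_all2_append)
qed

lemma card_cyc_factorizations_append:
  "card (cyc_factorizations u (as @ bs)) =
    (\<Sum>(f, g)\<in>length_additive_factorizations u.
      card (cyc_factorizations f as) * card (cyc_factorizations g bs))"
proof -
  let ?S = "SIGMA p:length_additive_factorizations u.
    cyc_factorizations (fst p) as \<times> cyc_factorizations (snd p) bs"
  let ?append = "\<lambda>(p, vs, ws). vs @ ws"
  have product: "f = comp_list vs" if "vs \<in> cyc_factorizations f cs" for f vs cs
    using that by (simp add: cyc_factorizations_def)
  have inj: "inj_on ?append ?S"
    unfolding inj_on_def by clarsimp (metis append_eq_append_conv length_cyc_factorizations product)
  have image: "?append ` ?S = cyc_factorizations u (as @ bs)"
  proof (intro set_eqI iffI)
    fix l assume "l \<in> ?append ` ?S"
    then obtain f g vs ws where fg: "(f, g) \<in> length_additive_factorizations u" "l = vs @ ws"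
        "vs \<in> cyc_factorizations f as" "ws \<in> cyc_factorizations g bs" by auto
    then show "l \<in> cyc_factorizations u (as @ bs)"
      using append_mem_cyc_factorizations_iff [OF length_cyc_factorizations [OF fg(3)]]
        product [OF fg(3)] product [OF fg(4)]
      by simp
  next
    fix l assume l: "l \<in> cyc_factorizations u (as @ bs)"
    let ?vs = "take (length as) l" and ?ws = "drop (length as) l"
    have "length ?vs = length as" using length_cyc_factorizations [OF l] by simp
    then have "((comp_list ?vs, comp_list ?ws), ?vs, ?ws) \<in> ?S"
      using append_mem_cyc_factorizations_iff [of ?vs as ?ws u bs] l by simp
    then show "l \<in> ?append ` ?S" by (rule rev_image_eqI) simp
  qed
  have "card (cyc_factorizations u (as @ bs)) = card ?S" using card_image [OF inj] unfolding image .
  also have "card ?S = (\<Sum>p\<in>length_additive_factorizations u.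
      card (cyc_factorizations (fst p) as \<times> cyc_factorizations (snd p) bs))"
    by (intro card_SigmaI finite_length_additive_factorizations)
      (simp add: finite_cyc_factorizations)
  finally show ?thesis by (simp only: card_cartesian_product case_prod_unfold)
qed

lemma card_cyc_factorizations_Cons_cong:
  assumes "\<And>u. card (cyc_factorizations u as) = card (cyc_factorizations u bs)"
  shows "card (cyc_factorizations u (a # as)) = card (cyc_factorizations u (a # bs))"
  using card_cyc_factorizations_append [of u "[a]" as] card_cyc_factorizations_append [of u "[a]" bs]
  by (simp add: assms)

lemma card_cyc_factorizations_pair:
  "card (cyc_factorizations z [a, b]) = card {(u, v) \<in> cyc_dec_pairs z. alen n u = a \<and> alen n v = b}"
proof -
  have "cyc_factorizations z [a, b] =
      (\<lambda>(u, v). [u, v]) ` {(u, v) \<in> cyc_dec_pairs z. alen n u = a \<and> alen n v = b}"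
    by (auto simp: cyc_factorizations_def cyc_dec_pairs_iff comp_list_def list_all2_Cons2)
  then show ?thesis by (simp add: card_image inj_on_def)
qed

lemma card_cyc_factorizations_swap:
  "card (cyc_factorizations u (a # b # as)) = card (cyc_factorizations u (b # a # as))"
proof -
  have "card (cyc_factorizations z [a, b]) = card (cyc_factorizations z [b, a])"
    if "affine_perm n z" for z
    unfolding card_cyc_factorizations_pair by (rule card_cyc_dec_pairs_swap [OF that])
  then have "(\<Sum>(f, g)\<in>length_additive_factorizations u.
        card (cyc_factorizations f [a, b]) * card (cyc_factorizations g as)) =
      (\<Sum>(f, g)\<in>length_additive_factorizations u.
        card (cyc_factorizations f [b, a]) * card (cyc_factorizations g as))"
    by (intro sum.cong) (auto simp: length_additive_factorizations_def)
  then show ?thesis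
    using card_cyc_factorizations_append [of u "[a, b]" as]
      card_cyc_factorizations_append [of u "[b, a]" as]
    by simp
qed

lemma card_cyc_factorizations_move:
  "card (cyc_factorizations u (a # as @ bs)) = card (cyc_factorizations u (as @ a # bs))"
proof (induction as arbitrary: u)
  case (Cons b as)
  have "card (cyc_factorizations u (a # b # as @ bs)) = card (cyc_factorizations u (b # a # as @ bs))"
    by (rule card_cyc_factorizations_swap)
  also have "\<dots> = card (cyc_factorizations u (b # as @ a # bs))"
    by (rule card_cyc_factorizations_Cons_cong [OF Cons.IH])
  finally show ?case by simp
qed simp

lemma card_cyc_factorizations_mset_cong:
  "mset as = mset bs \<Longrightarrow> card (cyc_factorizations u as) = card (cyc_factorizations u bs)"
proof (induction as arbitrary: bs u)
  case (Cons a as)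
  then obtain bs\<^sub>1 bs\<^sub>2 where bs: "bs = bs\<^sub>1 @ a # bs\<^sub>2"
    by (metis list.set_intros(1) mset_eq_setD split_list)
  then have "mset as = mset (bs\<^sub>1 @ bs\<^sub>2)" using Cons.prems by simp
  then have "card (cyc_factorizations u (a # as)) = card (cyc_factorizations u (a # bs\<^sub>1 @ bs\<^sub>2))"
    by (intro card_cyc_factorizations_Cons_cong Cons.IH)
  then show ?case by (simp add: bs card_cyc_factorizations_move)
qed simp

lemma card_cyc_factorizations_0: "card (cyc_factorizations u (0 # as)) = card (cyc_factorizations u as)"
proof -
  have "cyc_dec n v \<and> alen n v = 0 \<longleftrightarrow> v = id" for v
    using alen_0_imp_id [OF affine_perm_cyc_dec] cyc_dec_id alen_id by blast
  then have "cyc_factorizations u (0 # as) = (#) id ` cyc_factorizations u as"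
    by (auto simp: cyc_factorizations_def list_all2_Cons2 comp_list_Cons)
  then show ?thesis by (simp add: card_image)
qed

lemma card_cyc_factorizations_filter:
  "card (cyc_factorizations u (filter (\<lambda>a. a \<noteq> 0) as)) = card (cyc_factorizations u as)"
  by (induction as arbitrary: u)
    (auto simp: card_cyc_factorizations_0 intro: card_cyc_factorizations_Cons_cong)

lemma affine_stanley_coeff_eq:
  "affine_stanley_coeff n u \<alpha> = card (cyc_factorizations u (exponent_partition \<alpha>))"
proof -
  let ?N = "ybound \<alpha>" and ?f = "Poly_Mapping.lookup \<alpha>"
  let ?as = "map ?f [0..<?N]"
  have sum: "(\<Sum>i<?N. ?f i) = sum_list ?as"
    by (simp add: interv_sum_list_conv_sum_set_nat atLeast0LessThan)
  have "affine_stanley_coeff n u \<alpha> = card (cyc_factorizations u ?as)"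
    unfolding affine_stanley_coeff_def cyc_factorizations_def sum comp_list_def
    by (rule arg_cong [where f = card]) (auto simp: list_all2_conv_all_nth)
  also have "\<dots> = card (cyc_factorizations u (filter (\<lambda>a. a \<noteq> 0) ?as))"
    by (simp only: card_cyc_factorizations_filter)
  also have "\<dots> = card (cyc_factorizations u (exponent_partition \<alpha>))"
  proof (rule card_cyc_factorizations_mset_cong)
    have "Poly_Mapping.keys \<alpha> \<subseteq> {0..<?N}"
      by (auto simp: ybound_def less_Suc_eq_le)
    then have "{i \<in> {0..<?N}. ?f i \<noteq> 0} = Poly_Mapping.keys \<alpha>" by (auto simp: in_keys_iff)
    then show "mset (filter (\<lambda>a. a \<noteq> 0) ?as) = mset (exponent_partition \<alpha>)"
      by (simp add: mset_exponent_partition mset_filter filter_mset_image_mset)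
  qed
  finally show ?thesis .
qed

definition parabolic_factorizations :: "(int \<Rightarrow> int) \<Rightarrow> ((int \<Rightarrow> int) \<times> (int \<Rightarrow> int)) set" where
  "parabolic_factorizations w = {(u, v) \<in> length_additive_factorizations w. fin_perm n v}"

definition aff_schub_mono_coeff :: "(int \<Rightarrow> int) \<Rightarrow> nat list \<Rightarrow> (nat \<Rightarrow>\<^sub>0 nat) \<Rightarrow> int" where
  "aff_schub_mono_coeff w lam a = (\<Sum>(u, v)\<in>parabolic_factorizations w.
    int (card (cyc_factorizations u lam)) * Poly_Mapping.lookup (schub n v) a)"

lemma finite_parabolic_factorizations: "finite (parabolic_factorizations w)"
  by (rule finite_subset [OF _ finite_length_additive_factorizations])
    (auto simp: parabolic_factorizations_def)

lemma aff_schub_coeff_eq: "aff_schub_coeff n w \<alpha> a = aff_schub_mono_coeff w (exponent_partition \<alpha>) a"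
  unfolding aff_schub_coeff_def aff_schub_mono_coeff_def affine_stanley_coeff_eq
  by (rule sum.cong)
    (auto simp: parabolic_factorizations_def length_additive_factorizations_def fin_perm_def)

lemma aff_schub_mono_coeff_nonneg: "aff_schub_mono_coeff w lam a \<ge> 0"
  unfolding aff_schub_mono_coeff_def
  by (intro sum_nonneg) (auto simp: parabolic_factorizations_def schub_nonneg)

lemma finite_support_aff_schub_mono_coeff:
  "finite {(lam, a). is_partition lam \<and> aff_schub_mono_coeff w lam a \<noteq> 0}"
proof (rule finite_subset)
  let ?S = "\<Union>(u, v)\<in>parabolic_factorizations w.
    {lam. is_partition lam \<and> sum_list lam = alen n u} \<times> Poly_Mapping.keys (schub n v)"
  show "finite ?S" using finite_parabolic_factorizations finite_partitions by auto
  show "{(lam, a). is_partition lam \<and> aff_schub_mono_coeff w lam a \<noteq> 0} \<subseteq> ?S"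
  proof (intro subsetI, clarify)
    fix lam a assume lam: "is_partition lam" and "aff_schub_mono_coeff w lam a \<noteq> 0"
    then obtain u v where uv: "(u, v) \<in> parabolic_factorizations w"
        "card (cyc_factorizations u lam) \<noteq> 0" "Poly_Mapping.lookup (schub n v) a \<noteq> 0"
      unfolding aff_schub_mono_coeff_def by (auto elim!: sum.not_neutral_contains_not_neutral)
    then have "cyc_factorizations u lam \<noteq> {}" by (metis card.empty)
    then have "sum_list lam = alen n u" by (auto simp: cyc_factorizations_def)
    then show "(lam, a) \<in> ?S" using uv lam by (auto simp: in_keys_iff)
  qed
qed

end

theorem theorem6p1:
  fixes n :: nat and w :: "int \<Rightarrow> int"
  assumes "n \<ge> 2" and "affine_perm n w"
  shows "\<exists>c :: nat list \<times> (nat \<Rightarrow>\<^sub>0 nat) \<Rightarrow> nat.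
           finite {p. c p \<noteq> 0} \<and> (\<forall>p. c p \<noteq> 0 \<longrightarrow> is_partition (fst p)) \<and>
           (\<forall>\<alpha> a. aff_schub_coeff n w \<alpha> a =
              (\<Sum>p\<in>{p. c p \<noteq> 0}. int (c p) * mono_sym (fst p) \<alpha> * (if snd p = a then 1 else 0)))"
proof -
  interpret affine_symmetric_group n by unfold_locales (rule assms(1))
  define c where
    "c p = (if is_partition (fst p) then nat (aff_schub_mono_coeff w (fst p) (snd p)) else 0)" for p
  have fin: "finite {p. c p \<noteq> 0}"
    by (rule finite_subset [OF _ finite_support_aff_schub_mono_coeff [of w]]) (auto simp: c_def)
  have "aff_schub_coeff n w \<alpha> a =
      (\<Sum>p\<in>{p. c p \<noteq> 0}. int (c p) * mono_sym (fst p) \<alpha> * (if snd p = a then 1 else 0))" for \<alpha> a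
  proof -
    let ?p = "(exponent_partition \<alpha>, a)"
    have "aff_schub_coeff n w \<alpha> a = int (c ?p)"
      by (simp add: c_def aff_schub_coeff_eq aff_schub_mono_coeff_nonneg is_partition_exponent_partition)
    also have "\<dots> = (\<Sum>p\<in>{p. c p \<noteq> 0}. if p = ?p then int (c p) else 0)"
      using fin by (simp add: sum.delta')
    also have "\<dots> = (\<Sum>p\<in>{p. c p \<noteq> 0}. int (c p) * mono_sym (fst p) \<alpha> * (if snd p = a then 1 else 0))"
      by (intro sum.cong refl) (auto simp: mono_sym_eq prod_eq_iff)
    finally show ?thesis .
  qed
  moreover have "\<forall>p. c p \<noteq> 0 \<longrightarrow> is_partition (fst p)" by (simp add: c_def)
  ultimately show ?thesis using fin by blast
qed

end
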